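(* Let $(T,d,\rho)$ be a Polish $\mathbb{R}$-tree, and let $\mu\in\mathscr{M}_{\rm di}(T)$. Then for every $h>0$ the $h$-mass-erased subtree $R_{\mu,h}(T)=\{\rho\}\cup\{\sigma\in T : \mu(\theta_\sigma T)\ge h\}$ is a discrete $\mathbb{R}$-tree.
   Context: An $\mathbb{R}$-tree is a pointed metric space $(T,d,\rho)$ (root $\rho$) such that any $\sigma_1,\sigma_2\in T$ are the end points of a unique segment $[\sigma_1,\sigma_2]$ (isometric image of a compact real interval), and whenever two segments satisfy $[\sigma_1,\sigma_0]\cap[\sigma_0,\sigma_2]=\{\sigma_0\}$, their union is a segment with end points $\sigma_1,\sigma_2$. It is called Polish if $(T,d)$ is complete and separable. Set $\theta_\sigma T=\{\sigma'\in T:\sigma\in[\rho,\sigma']\}$. For $r>0$, $\overline B_T(\rho,r)=\{\sigma: d(\rho,\sigma)\le r\}$ and $\partial B_T(\rho,r)=\{\sigma:d(\rho,\sigma)=r\}$. The degree $n(\sigma,T)\in\mathbb{N}_0\cup\{+\infty\}$ is the number of connected components of $T\setminus\{\sigma\}$, and ${\rm Bp}(T)=\{\sigma\in T\setminus\{\rho\}: n(\sigma,T)\ge 3\}$. An $\mathbb{R}$-tree $T$ is discrete if it is complete and $n(\rho,T)+\sum_{\sigma\in{\rm Bp}(T)\cap\overline B_T(\rho,r)}n(\sigma,T)<\infty$ for all $r>0$. A Borel measure on $T$ is boundedly finite if it is finite on bounded Borel sets; $\mathscr{M}_{\rm bf}(T)$ is the set of these and $\mathscr{M}_{\rm fin}(T)$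 the set of finite Borel measures. For $\mu\in\mathscr{M}_{\rm bf}(T)$ let ${\rm Skel}(T,\mu)=\{\rho\}\cup\{\sigma\in T:\mu(\theta_\sigma T)=+\infty\}$ and $F_\mu(T)=T\setminus{\rm Skel}(T,\mu)$. $\mu$ is discretely infinite if $\mu(T)=+\infty$, ${\rm Skel}(T,\mu)$ (with the restricted metric and root $\rho$) is a discrete $\mathbb{R}$-tree, and $\mu\big(\bigcup_{\sigma\in\partial B_T(\rho,r)\cap F_\mu(T)}\theta_\sigma T\big)<\infty$ for all $r>0$. $\mathscr{M}_{\rm di}(T)$ denotes the set of all finite or discretely infinite measures on $T$. *)

theory Defs
  imports "HOL-Analysis.Analysis"
begin

text \<open>
  A metric space \<open>(T, d)\<close> is a subset \<open>T\<close> of a type of class \<open>metric_space\<close>, with \<open>d\<close> the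
  restriction of \<^const>\<open>dist\<close>; subtrees then carry the restricted metric automatically.
\<close>

definition is_segment :: "'a::metric_space set \<Rightarrow> 'a \<Rightarrow> 'a \<Rightarrow> bool" where
  "is_segment S x y \<longleftrightarrow>
     (\<exists>a b (f :: real \<Rightarrow> 'a). a \<le> b \<and>
        (\<forall>s\<in>{a..b}. \<forall>t\<in>{a..b}. dist (f s) (f t) = \<bar>s - t\<bar>) \<and>
        f ` {a..b} = S \<and> f a = x \<and> f b = y)"

definition R_tree :: "'a::metric_space set \<Rightarrow> 'a \<Rightarrow> bool" where
  "R_tree T \<rho> \<longleftrightarrow>
     \<rho> \<in> T \<and>
     (\<forall>x\<in>T. \<forall>y\<in>T. \<exists>!S. S \<subseteq> T \<and> is_segment S x y) \<and>
     (\<forall>x0\<in>T. \<forall>x1\<in>T. \<forall>x2\<in>T. \<forall>S1 S2.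
        S1 \<subseteq> T \<and> is_segment S1 x1 x0 \<and> S2 \<subseteq> T \<and> is_segment S2 x0 x2 \<and> S1 \<inter> S2 = {x0}
        \<longrightarrow> is_segment (S1 \<union> S2) x1 x2)"

definition polish_R_tree :: "'a::metric_space set \<Rightarrow> 'a \<Rightarrow> bool" where
  "polish_R_tree T \<rho> \<longleftrightarrow> R_tree T \<rho> \<and> complete T \<and> separable_space (top_of_set T)"

text \<open>The segment \<open>[x, y]\<close> of \<open>T\<close>; it is only specified when \<open>T\<close> is an R-tree and \<open>x, y \<in> T\<close>.\<close>

definition seg :: "'a::metric_space set \<Rightarrow> 'a \<Rightarrow> 'a \<Rightarrow> 'a set" where
  "seg T x y = (THE S. S \<subseteq> T \<and> is_segment S x y)"

definition fringe :: "'a::metric_space set \<Rightarrow> 'a \<Rightarrow> 'a \<Rightarrow> 'a set" where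
  "fringe T \<rho> \<sigma> = {\<sigma>' \<in> T. \<sigma> \<in> seg T \<rho> \<sigma>'}"

definition tree_degree :: "'a::metric_space \<Rightarrow> 'a set \<Rightarrow> enat" where
  "tree_degree \<sigma> T =
     (if finite (components (T - {\<sigma>})) then enat (card (components (T - {\<sigma>}))) else \<infinity>)"

definition branch_points :: "'a::metric_space set \<Rightarrow> 'a \<Rightarrow> 'a set" where
  "branch_points T \<rho> = {\<sigma> \<in> T - {\<rho>}. tree_degree \<sigma> T \<ge> 3}"

text \<open>
  The sum in the next definition may range over an infinite set. Every family in \<^typ>\<open>enat\<close> is
  summable in the sense of \<^const>\<open>infsum\<close>, the value being the supremum of the finite partial sums.
\<close>

lemma enat_infsum_eq_SUP:
  fixes f :: "'b \<Rightarrow> enat"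
  shows "f summable_on A" and "infsum f A = (SUP F\<in>{F. finite F \<and> F \<subseteq> A}. sum f F)"
  by (rule nonneg_summable_on_complete, simp) (rule nonneg_infsum_complete, simp)

definition discrete_R_tree :: "'a::metric_space set \<Rightarrow> 'a \<Rightarrow> bool" where
  "discrete_R_tree T \<rho> \<longleftrightarrow>
     R_tree T \<rho> \<and> complete T \<and>
     (\<forall>r>0. tree_degree \<rho> T + (\<Sum>\<^sub>\<infinity>\<sigma>\<in>branch_points T \<rho> \<inter> cball \<rho> r. tree_degree \<sigma> T) < \<infinity>)"

text \<open>The traces on \<open>T\<close> of Borel sets of the ambient type are the Borel sets of the subspace \<open>T\<close>.\<close>

definition borel_measures_on :: "'a::metric_space set \<Rightarrow> 'a measure set" where
  "borel_measures_on T = {\<mu>. sets \<mu> = sets (restrict_space borel T)}"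

definition boundedly_finite_measures :: "'a::metric_space set \<Rightarrow> 'a measure set" where
  "boundedly_finite_measures T =
     {\<mu> \<in> borel_measures_on T. \<forall>B\<in>sets \<mu>. bounded B \<longrightarrow> emeasure \<mu> B < \<infinity>}"

definition finite_measures :: "'a::metric_space set \<Rightarrow> 'a measure set" where
  "finite_measures T = {\<mu> \<in> borel_measures_on T. finite_measure \<mu>}"

definition Skel :: "'a::metric_space set \<Rightarrow> 'a \<Rightarrow> 'a measure \<Rightarrow> 'a set" where
  "Skel T \<rho> \<mu> = {\<rho>} \<union> {\<sigma> \<in> T. emeasure \<mu> (fringe T \<rho> \<sigma>) = \<infinity>}"

definition finite_part :: "'a::metric_space set \<Rightarrow> 'a \<Rightarrow> 'a measure \<Rightarrow> 'a set" where
  "finite_part T \<rho> \<mu> = T - Skel T \<rho> \<mu>"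

definition discretely_infinite :: "'a::metric_space set \<Rightarrow> 'a \<Rightarrow> 'a measure \<Rightarrow> bool" where
  "discretely_infinite T \<rho> \<mu> \<longleftrightarrow>
     \<mu> \<in> boundedly_finite_measures T \<and>
     emeasure \<mu> T = \<infinity> \<and>
     discrete_R_tree (Skel T \<rho> \<mu>) \<rho> \<and>
     (\<forall>r>0. emeasure \<mu> (\<Union>\<sigma>\<in>sphere \<rho> r \<inter> finite_part T \<rho> \<mu>. fringe T \<rho> \<sigma>) < \<infinity>)"

definition di_measures :: "'a::metric_space set \<Rightarrow> 'a \<Rightarrow> 'a measure set" where
  "di_measures T \<rho> = finite_measures T \<union> {\<mu>. discretely_infinite T \<rho> \<mu>}"

definition mass_erased :: "'a::metric_space set \<Rightarrow> 'a \<Rightarrow> 'a measure \<Rightarrow> real \<Rightarrow> 'a set" where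
  "mass_erased T \<rho> \<mu> h = {\<rho>} \<union> {\<sigma> \<in> T. emeasure \<mu> (fringe T \<rho> \<sigma>) \<ge> ennreal h}"

end

theory Submission
  imports Defs
begin

text \<open>
  Let \<open>S\<close> be the skeleton and \<open>R\<close> the mass-erased subtree; for finite \<open>\<mu>\<close> the skeleton is
  \<open>{\<rho>}\<close>, so both cases of \<^term>\<open>di_measures\<close> can be treated at once. Order \<open>T\<close> by
  \<open>x \<preceq> y\<close> iff \<open>x \<in> [\<rho>, y]\<close>. Incomparable points have disjoint fringes, and the fringes of points
  of \<open>R - S\<close> at height at most \<open>r\<close> lie in the union of the ball of radius \<open>r\<close> and of the
  finite-mass fringes over the sphere of radius \<open>r\<close>. Since each of them has mass at least \<open>h\<close>, the
  antichains of \<open>R - S\<close> in a ball have bounded size. This bounds the branch points \<open>\<sigma>\<close> of \<open>R\<close> in a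
  ball: \<open>n\<close> branch points outside \<open>S\<close> give an antichain of \<open>n + 1\<close> points just above them; those in
  \<open>S\<close> either branch already in \<open>S\<close>, or carry a branch of \<open>R\<close> that avoids \<open>S\<close>, and one point on
  each of these branches gives an antichain. Completeness of \<open>R\<close> is continuity of \<open>\<mu>\<close> from above
  along \<open>[\<rho>, \<sigma>]\<close>, applicable because \<open>S\<close> is closed.
\<close>

section \<open>Betweenness and the tree order\<close>

text \<open>Stated by distances alone, betweenness does not depend on the ambient tree, and segment
  arguments become linear arithmetic. In an R-tree, \<open>seg_eq\<close> identifies it with
  membership in a segment.\<close>

definition btw :: "'a::metric_space \<Rightarrow> 'a \<Rightarrow> 'a \<Rightarrow> bool" where
  "btw x z y \<longleftrightarrow> dist x z + dist z y = dist x y"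

lemma btw_commute: "btw x z y \<longleftrightarrow> btw y z x"
  by (auto simp: btw_def dist_commute)

lemma btw_refl [simp]: "btw x x y" "btw x y y"
  by (auto simp: btw_def)

lemma btw_same [simp]: "btw x z x \<longleftrightarrow> z = x"
  by (auto simp: btw_def dist_commute)

text \<open>This rule and the next three rest on the triangle inequality alone, so they hold in
  every metric space. The primed versions place \<open>w\<close> on the second piece instead of the
  first.\<close>

lemma btw_trans: "btw x z y \<Longrightarrow> btw x w z \<Longrightarrow> btw x w y"
  using dist_triangle[of w y z] dist_triangle[of x y w] unfolding btw_def by linarith

lemma btw_inner: "btw x z y \<Longrightarrow> btw x w z \<Longrightarrow> btw w z y"
  using dist_triangle[of w y z] dist_triangle[of x y w] unfolding btw_def by linarith

lemma btw_trans': "btw x z y \<Longrightarrow> btw z w y \<Longrightarrow> btw x w y"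
  using dist_triangle[of x w z] dist_triangle[of x y w] unfolding btw_def by linarith

lemma btw_inner': "btw x z y \<Longrightarrow> btw z w y \<Longrightarrow> btw x z w"
  using dist_triangle[of x w z] dist_triangle[of x y w] unfolding btw_def by linarith

section \<open>Segments as isometric images of intervals\<close>

lemma is_segmentE:
  assumes "is_segment S x y"
  obtains a b and f :: "real \<Rightarrow> 'a::metric_space" where "a \<le> b"
    "\<And>s t. s \<in> {a..b} \<Longrightarrow> t \<in> {a..b} \<Longrightarrow> dist (f s) (f t) = \<bar>s - t\<bar>"
    "S = f ` {a..b}" "x = f a" "y = f b"
proof -
  from assms obtain a b and f :: "real \<Rightarrow> 'a" where "a \<le> b"
    "\<forall>s\<in>{a..b}. \<forall>t\<in>{a..b}. dist (f s) (f t) = \<bar>s - t\<bar>"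
    "f ` {a..b} = S" "f a = x" "f b = y"
    unfolding is_segment_def by (elim exE conjE)
  then show ?thesis by (intro that[of a b f]) simp_all
qed

lemma is_segment_btw:
  assumes "is_segment S x y" "z \<in> S"
  shows "btw x z y"
  using assms by (elim is_segmentE) (auto simp: btw_def)

lemma is_segment_dist:
  assumes "is_segment S x y" "z \<in> S" "w \<in> S"
  shows "dist z w = \<bar>dist x z - dist x w\<bar>"
  using assms by (elim is_segmentE) auto

lemma is_segment_ex_point:
  assumes "is_segment S x y" "0 \<le> t" "t \<le> dist x y"
  shows "\<exists>z\<in>S. dist x z = t"
  using assms(1)
proof (rule is_segmentE)
  fix a b and f :: "real \<Rightarrow> 'a"
  assume ab: "a \<le> b"
    and iso: "\<And>s t. s \<in> {a..b} \<Longrightarrow> t \<in> {a..b} \<Longrightarrow> dist (f s) (f t) = \<bar>s - t\<bar>"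
    and f: "S = f ` {a..b}" "x = f a" "y = f b"
  have "dist x y = b - a" using iso[of a b] f ab by auto
  then have "a + t \<in> {a..b}" using assms by auto
  then show ?thesis using iso[of a "a + t"] f ab assms by (intro bexI[of _ "f (a + t)"]) auto
qed

lemma
  assumes "is_segment S x y"
  shows is_segment_compact: "compact S" and is_segment_connected: "connected S"
    and is_segment_endpoints: "x \<in> S" "y \<in> S"
proof -
  obtain a b and f :: "real \<Rightarrow> 'a" where ab: "a \<le> b"
    and iso: "\<And>s t. s \<in> {a..b} \<Longrightarrow> t \<in> {a..b} \<Longrightarrow> dist (f s) (f t) = \<bar>s - t\<bar>"
    and f: "S = f ` {a..b}" "x = f a" "y = f b"
    by (rule is_segmentE[OF assms]) (rule that; assumption)
  have "continuous_on {a..b} f"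
    unfolding continuous_on_iff
  proof (intro ballI allI impI)
    fix s e :: real
    assume "s \<in> {a..b}" "0 < e"
    then show "\<exists>d>0. \<forall>t\<in>{a..b}. dist t s < d \<longrightarrow> dist (f t) (f s) < e"
      by (intro exI[of _ e]) (simp add: iso dist_real_def)
  qed
  then show "compact S" "connected S"
    unfolding f by (auto intro: compact_continuous_image connected_continuous_image)
  show "x \<in> S" "y \<in> S" using f ab by auto
qed

section \<open>Metric geometry of a rooted R-tree\<close>

locale rooted_R_tree =
  fixes T :: "'a::metric_space set" and \<rho> :: 'a
  assumes R_tree: "R_tree T \<rho>"
begin

abbreviation below :: "'a \<Rightarrow> 'a \<Rightarrow> bool" (infix "\<preceq>" 50) where
  "x \<preceq> y \<equiv> btw \<rho> x y"

lemma root_in: "\<rho> \<in> T"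
  using R_tree by (auto simp: R_tree_def)

lemma
  assumes "x \<in> T" "y \<in> T"
  shows seg_subset: "seg T x y \<subseteq> T" and is_segment_seg: "is_segment (seg T x y) x y"
    and seg_unique: "\<And>S. S \<subseteq> T \<Longrightarrow> is_segment S x y \<Longrightarrow> S = seg T x y"
proof -
  have ex1: "\<exists>!S. S \<subseteq> T \<and> is_segment S x y"
    using R_tree assms unfolding R_tree_def by simp
  from theI'[OF ex1] show "seg T x y \<subseteq> T" "is_segment (seg T x y) x y"
    unfolding seg_def by simp_all
  show "\<And>S. S \<subseteq> T \<Longrightarrow> is_segment S x y \<Longrightarrow> S = seg T x y"
    unfolding seg_def using the1_equality[OF ex1] by simp
qed

text \<open>The gluing axiom makes the union a segment, and uniqueness forces it to be
  \<open>seg T x y\<close>. An inclusion suffices as hypothesis because \<open>z\<close> is an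
  endpoint of both pieces.\<close>

lemma glue_segments:
  assumes "x \<in> T" "z \<in> T" "y \<in> T" "seg T x z \<inter> seg T z y \<subseteq> {z}"
  shows "z \<in> seg T x y"
proof -
  note s = is_segment_seg[OF assms(1,2)] is_segment_seg[OF assms(2,3)]
  note sub = seg_subset[OF assms(1,2)] seg_subset[OF assms(2,3)]
  have i: "seg T x z \<inter> seg T z y = {z}"
    using assms(4) is_segment_endpoints(2)[OF s(1)] is_segment_endpoints(1)[OF s(2)] by blast
  have "\<forall>x0\<in>T. \<forall>x1\<in>T. \<forall>x2\<in>T. \<forall>S1 S2.
      S1 \<subseteq> T \<and> is_segment S1 x1 x0 \<and> S2 \<subseteq> T \<and> is_segment S2 x0 x2 \<and> S1 \<inter> S2 = {x0}
        \<longrightarrow> is_segment (S1 \<union> S2) x1 x2"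
    using R_tree unfolding R_tree_def by (elim conjE)
  from this[rule_format, OF assms(2,1,3)]
  have "is_segment (seg T x z \<union> seg T z y) x y"
    using s sub i by simp
  then have "seg T x z \<union> seg T z y = seg T x y"
    using seg_unique[OF assms(1,3)] sub by simp
  then show ?thesis using i by blast
qed

lemma seg_eq:
  assumes "x \<in> T" "y \<in> T"
  shows "seg T x y = {z \<in> T. btw x z y}"
proof (intro equalityI subsetI)
  fix z assume "z \<in> seg T x y"
  then show "z \<in> {z \<in> T. btw x z y}"
    using is_segment_btw[OF is_segment_seg[OF assms]] seg_subset[OF assms] by auto
next
  fix z assume z: "z \<in> {z \<in> T. btw x z y}"
  show "z \<in> seg T x y"
  proof (rule glue_segments)
    show "seg T x z \<inter> seg T z y \<subseteq> {z}"
    proof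
      fix w assume "w \<in> seg T x z \<inter> seg T z y"
      then have "btw x w z" "btw z w y"
        using z is_segment_btw[OF is_segment_seg[OF assms(1), of z]]
          is_segment_btw[OF is_segment_seg[OF _ assms(2), of z]] by auto
      moreover have "btw x z y" using z by simp
      \<comment> \<open>A point on both pieces would be passed twice: comparing the lengths with
        \<open>dist x y\<close> bounds twice \<open>dist w z\<close> by 0.\<close>
      ultimately have "dist w z \<le> 0"
        using dist_triangle[of x y w] dist_commute[of z w] unfolding btw_def by linarith
      then show "w \<in> {z}" by simp
    qed
  qed (use assms z in auto)
qed

lemma dist_btw:
  assumes "x \<in> T" "y \<in> T" "z \<in> T" "w \<in> T" "btw x z y" "btw x w y"
  shows "dist z w = \<bar>dist x z - dist x w\<bar>"
  by (rule is_segment_dist[OF is_segment_seg[OF assms(1,2)]])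
    (simp_all add: seg_eq[OF assms(1,2)] assms(3-6))

lemma ex_point:
  assumes "x \<in> T" "y \<in> T" "0 \<le> t" "t \<le> dist x y"
  shows "\<exists>z\<in>T. dist x z = t \<and> btw x z y"
  using is_segment_ex_point[OF is_segment_seg[OF assms(1,2)] assms(3,4)] seg_eq[OF assms(1,2)] by auto

lemma btw_linear:
  assumes "x \<in> T" "y \<in> T" "z \<in> T" "w \<in> T" "btw x z y" "btw x w y" "dist x z \<le> dist x w"
  shows "btw x z w"
  using dist_btw[OF assms(1-6)] assms(7) by (simp add: btw_def)

text \<open>The median is the point common to the segments from \<open>x\<close> to \<open>y\<close>
  and from \<open>x\<close> to \<open>z\<close> that is furthest from \<open>x\<close>, which exists
  by compactness. A second meeting point of the remaining pieces would be further away
  still.\<close>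

lemma median:
  assumes "x \<in> T" "y \<in> T" "z \<in> T"
  shows "\<exists>m\<in>T. btw x m y \<and> btw x m z \<and> btw y m z"
proof -
  let ?K = "seg T x y \<inter> seg T x z"
  note s = is_segment_seg[OF assms(1,2)] is_segment_seg[OF assms(1,3)]
  have "compact ?K" using is_segment_compact[OF s(1)] is_segment_compact[OF s(2)] by (rule compact_Int)
  moreover have "?K \<noteq> {}" using is_segment_endpoints(1)[OF s(1)] is_segment_endpoints(1)[OF s(2)] by blast
  moreover have "continuous_on ?K (\<lambda>m. dist x m)" by (intro continuous_intros)
  ultimately obtain m where m: "m \<in> ?K" and max: "\<And>w. w \<in> ?K \<Longrightarrow> dist x w \<le> dist x m"
    using continuous_attains_sup[of ?K "\<lambda>m. dist x m"] by blast
  have mT: "m \<in> T" and mb: "btw x m y" "btw x m z" using m seg_eq[OF assms(1,2)] seg_eq[OF assms(1,3)] by auto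
  have "m \<in> seg T y z"
  proof (rule glue_segments)
    show "seg T y m \<inter> seg T m z \<subseteq> {m}"
    proof
      fix w assume "w \<in> seg T y m \<inter> seg T m z"
      then have w: "w \<in> T" "btw y w m" "btw m w z"
        using seg_eq[OF assms(2) mT] seg_eq[OF mT assms(3)] by auto
      then have "btw m w y" using btw_commute[of y w m] by blast
      have "btw x w y" "btw x w z" "btw x m w"
        using btw_trans'[OF mb(1) \<open>btw m w y\<close>] btw_trans'[OF mb(2) w(3)]
          btw_inner'[OF mb(2) w(3)] .
      then have "dist x w \<le> dist x m" using max[of w] w(1) seg_eq[OF assms(1,2)] seg_eq[OF assms(1,3)] by simp
      then have "dist m w \<le> 0" using \<open>btw x m w\<close> unfolding btw_def by linarith
      then show "w \<in> {m}" by simp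
    qed
  qed (use assms mT in auto)
  then show ?thesis using mT mb seg_eq[OF assms(2,3)] by auto
qed

text \<open>Triangles are tripods: a point between \<open>x\<close> and \<open>z\<close> lies before
  or after the median, hence on one of the other two sides. Read contrapositively, not being
  separated by \<open>\<sigma>\<close> is transitive.\<close>

lemma btw_tri:
  assumes "x \<in> T" "y \<in> T" "z \<in> T" "\<sigma> \<in> T" "btw x \<sigma> z"
  shows "btw x \<sigma> y \<or> btw y \<sigma> z"
proof -
  obtain m where m: "m \<in> T" "btw x m y" "btw x m z" "btw y m z"
    using median[OF assms(1-3)] by blast
  show ?thesis
  proof (cases "dist x \<sigma> \<le> dist x m")
    case True
    then have "btw x \<sigma> m" using btw_linear[OF assms(1,3,4) m(1) assms(5) m(3)] by blast
    then show ?thesis using btw_trans[OF m(2)] by blast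
  next
    case False
    then have "btw x m \<sigma>"
      using btw_linear[OF assms(1,3) m(1) assms(4) m(3) assms(5)] by simp
    then have "btw m \<sigma> z" using btw_inner[OF assms(5)] by blast
    then show ?thesis using btw_trans'[OF m(4)] by blast
  qed
qed

lemma below_linear:
  assumes "x \<in> T" "y \<in> T" "z \<in> T" "x \<preceq> z" "y \<preceq> z"
  shows "x \<preceq> y \<or> y \<preceq> x"
  using btw_linear[OF root_in assms(3,1,2,4,5)] btw_linear[OF root_in assms(3,2,1,5,4)]
  by linarith

lemma below_dist: "x \<preceq> y \<Longrightarrow> dist \<rho> x \<le> dist \<rho> y"
  using zero_le_dist[of x y] unfolding btw_def by linarith

lemma below_trans: "x \<preceq> y \<Longrightarrow> y \<preceq> z \<Longrightarrow> x \<preceq> z"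
  by (rule btw_trans)

lemma btw_imp_below:
  assumes "x \<in> T" "y \<in> T" "z \<in> T" "btw x z y"
  shows "z \<preceq> x \<or> z \<preceq> y"
  using btw_tri[OF assms(1) root_in assms(2,3,4)] btw_commute[of x z \<rho>] by blast

text \<open>Since \<open>x\<close> lies between \<open>\<sigma>\<close> and \<open>y\<close>, a
  detour from \<open>x\<close> through \<open>\<sigma>\<close> would be too long. Hence everything
  above \<open>x\<close> stays on the side of \<open>\<sigma>\<close> on which \<open>x\<close>
  lies.\<close>

lemma not_btw_above:
  assumes "\<sigma> \<preceq> x" "x \<preceq> y" "\<sigma> \<noteq> x"
  shows "\<not> btw x \<sigma> y"
proof -
  have "btw \<sigma> x y"
    using assms(1,2) dist_triangle[of \<rho> x \<sigma>] dist_triangle[of \<sigma> y x] dist_triangle[of \<rho> y \<sigma>]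
    unfolding btw_def by linarith
  then show ?thesis using assms(3) zero_less_dist_iff[of \<sigma> x] dist_commute[of x \<sigma>]
    unfolding btw_def by linarith
qed

lemma fringe_eq: "\<sigma> \<in> T \<Longrightarrow> fringe T \<rho> \<sigma> = {x \<in> T. \<sigma> \<preceq> x}"
  by (auto simp: fringe_def seg_eq root_in)

lemma fringe_mono:
  assumes "x \<in> T" "y \<in> T" "x \<preceq> y"
  shows "fringe T \<rho> y \<subseteq> fringe T \<rho> x"
  using assms(1,2) below_trans[OF assms(3)] by (auto simp: fringe_eq)

text \<open>A branch above \<open>\<sigma>\<close> can be represented at most one unit higher, so
  representatives chosen over a ball of radius \<open>r\<close> stay in the ball of radius
  \<open>r + 1\<close>.\<close>

lemma lower_point:
  assumes "\<sigma> \<in> T" "x \<in> T" "\<sigma> \<preceq> x" "x \<noteq> \<sigma>"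
  shows "\<exists>y\<in>T. \<sigma> \<preceq> y \<and> y \<noteq> \<sigma> \<and> y \<preceq> x \<and> dist \<rho> y \<le> dist \<rho> \<sigma> + 1"
proof -
  let ?t = "min 1 (dist \<sigma> x)"
  obtain y where y: "y \<in> T" "dist \<sigma> y = ?t" "btw \<sigma> y x"
    using ex_point[OF assms(1,2), of ?t] by auto
  have "\<sigma> \<preceq> y" "y \<preceq> x"
    using btw_inner'[OF assms(3) y(3)] btw_trans'[OF assms(3) y(3)] .
  moreover have "y \<noteq> \<sigma>" using y(2) assms(4) by (auto simp: min_def split: if_splits)
  moreover have "dist \<rho> y \<le> dist \<rho> \<sigma> + 1"
    using \<open>\<sigma> \<preceq> y\<close> y(2) unfolding btw_def by linarith
  ultimately show ?thesis using y(1) by blast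
qed

text \<open>Taking the ancestor at a fixed height is 1-Lipschitz: either the two ancestors coincide,
  or the path from \<open>z\<close> to \<open>w\<close> runs through both.\<close>

lemma dist_height_le:
  assumes "p \<in> T" "s \<in> T" "z \<in> T" "w \<in> T" "p \<preceq> z" "s \<preceq> w" "dist \<rho> p = dist \<rho> s"
  shows "dist p s \<le> dist z w"
proof -
  obtain m where m: "m \<in> T" "m \<preceq> z" "m \<preceq> w" "btw z m w"
    using median[OF root_in assms(3,4)] by blast
  have eq: "p = s" if "p \<preceq> v" "s \<preceq> v" "v \<in> T" for v
    using dist_btw[OF root_in \<open>v \<in> T\<close> assms(1,2) that(1,2)] assms(7) by simp
  consider "p \<preceq> m" | "s \<preceq> m" | "m \<preceq> p" "m \<preceq> s"
    using below_linear[OF assms(1) m(1) assms(3,5) m(2)]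
      below_linear[OF assms(2) m(1) assms(4,6) m(3)] by blast
  then show ?thesis
  proof cases
    case 1
    then show ?thesis using eq[of w] below_trans[OF 1 m(3)] assms by auto
  next
    case 2
    then show ?thesis using eq[of z] below_trans[OF 2 m(2)] assms by auto
  next
    case 3
    then have "btw m p z" "btw m s w"
      using btw_inner[OF assms(5)] btw_inner[OF assms(6)] by blast+
    then show ?thesis
      using dist_triangle[of p s m] m(4) zero_le_dist[of p z] zero_le_dist[of s w]
        dist_commute[of p m] dist_commute[of z m] unfolding btw_def by linarith
  qed
qed

section \<open>Subtrees and the components left by a point\<close>

text \<open>Closure under predecessors makes such a set an R-tree with the segments of
  \<open>T\<close>; the skeleton and the mass-erased set both have this form.\<close>

definition subtree :: "'a set \<Rightarrow> bool" where
  "subtree X \<longleftrightarrow> \<rho> \<in> X \<and> X \<subseteq> T \<and> (\<forall>y\<in>X. \<forall>x\<in>T. x \<preceq> y \<longrightarrow> x \<in> X)"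

lemma subtreeD:
  assumes "subtree X"
  shows "\<rho> \<in> X" "X \<subseteq> T" "y \<in> X \<Longrightarrow> x \<in> T \<Longrightarrow> x \<preceq> y \<Longrightarrow> x \<in> X"
  using assms unfolding subtree_def by auto

lemma seg_subset_subtree:
  assumes "subtree X" "x \<in> X" "y \<in> X"
  shows "seg T x y \<subseteq> X"
proof
  fix z assume z: "z \<in> seg T x y"
  have T: "x \<in> T" "y \<in> T" using assms subtreeD by auto
  then have "z \<in> T" "btw x z y" using z seg_eq by auto
  then show "z \<in> X"
    using btw_imp_below[OF T] subtreeD(3)[OF assms(1)] assms(2,3) by blast
qed

lemma R_tree_subtree:
  assumes "subtree X"
  shows "R_tree X \<rho>"
  unfolding R_tree_def
proof (intro conjI ballI allI impI)
  note XT = subtreeD(2)[OF assms, THEN subsetD]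
  show "\<rho> \<in> X" using subtreeD(1)[OF assms] .
  show "\<exists>!S. S \<subseteq> X \<and> is_segment S x y" if "x \<in> X" "y \<in> X" for x y
  proof (intro ex1I conjI)
    show "seg T x y \<subseteq> X" using seg_subset_subtree[OF assms that] .
    show "is_segment (seg T x y) x y" using is_segment_seg XT that by simp
    show "\<And>S. S \<subseteq> X \<and> is_segment S x y \<Longrightarrow> S = seg T x y"
      using seg_unique[of x y] XT that by (meson subsetI subset_iff)
  qed
  have glue: "\<forall>x0\<in>T. \<forall>x1\<in>T. \<forall>x2\<in>T. \<forall>S1 S2.
      S1 \<subseteq> T \<and> is_segment S1 x1 x0 \<and> S2 \<subseteq> T \<and> is_segment S2 x0 x2 \<and> S1 \<inter> S2 = {x0}
        \<longrightarrow> is_segment (S1 \<union> S2) x1 x2"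
    using R_tree unfolding R_tree_def by (elim conjE)
  show "is_segment (S1 \<union> S2) x1 x2"
    if "x0 \<in> X" "x1 \<in> X" "x2 \<in> X" "S1 \<subseteq> X \<and> is_segment S1 x1 x0 \<and> S2 \<subseteq> X \<and>
      is_segment S2 x0 x2 \<and> S1 \<inter> S2 = {x0}" for x0 x1 x2 S1 S2
    using that(4) subset_trans[OF _ subtreeD(2)[OF assms]]
    by (intro glue[rule_format, OF that(1-3)[THEN XT]]) simp
qed

text \<open>This translates components into betweenness, so that degrees can be counted by sets of
  points pairwise separated by \<open>\<sigma>\<close>.\<close>

lemma connected_component_iff:
  assumes X: "subtree X" and \<sigma>: "\<sigma> \<in> T" and x: "x \<in> X - {\<sigma>}" and y: "y \<in> X - {\<sigma>}"
  shows "connected_component (X - {\<sigma>}) x y \<longleftrightarrow> \<not> btw x \<sigma> y"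
proof
  note XT = subtreeD(2)[OF X, THEN subsetD]
  have T: "x \<in> T" "y \<in> T" using x y XT by auto
  assume "connected_component (X - {\<sigma>}) x y"
  then obtain C where C: "connected C" "C \<subseteq> X - {\<sigma>}" "x \<in> C" "y \<in> C"
    unfolding connected_component_def by blast
  \<comment> \<open>Separation from \<open>x\<close> by \<open>\<sigma>\<close> is locally constant
    on \<open>C\<close>, because a point nearer to \<open>z\<close> than \<open>\<sigma>\<close> is
    cannot be separated from \<open>z\<close> by \<open>\<sigma>\<close>. It fails at
    \<open>x\<close> itself.\<close>
  have "btw x \<sigma> x = btw x \<sigma> y"
  proof (rule connected_local_const[OF C(1,3,4)], intro ballI)
    fix z assume z: "z \<in> C"
    have "btw x \<sigma> z = btw x \<sigma> w" if w: "w \<in> C" "dist w z < dist z \<sigma>" for w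
    proof -
      have "\<not> btw z \<sigma> w" "\<not> btw w \<sigma> z"
        using w(2) zero_le_dist[of \<sigma> w] dist_commute[of z w] dist_commute[of z \<sigma>]
          zero_le_dist[of w \<sigma>] unfolding btw_def by linarith+
      moreover have "z \<in> T" "w \<in> T" using z w C(2) XT by auto
      ultimately show ?thesis using btw_tri[OF T(1) _ _ \<sigma>] by blast
    qed
    moreover have "dist z \<sigma> > 0" using z C(2) by auto
    ultimately show "\<forall>\<^sub>F w in at z within C. btw x \<sigma> z = btw x \<sigma> w"
      unfolding eventually_at by blast
  qed
  then show "\<not> btw x \<sigma> y" using x by auto
next
  assume *: "\<not> btw x \<sigma> y"
  have T: "x \<in> T" "y \<in> T" using x y subtreeD(2)[OF X] by auto
  note seg = is_segment_seg[OF T]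
  have "seg T x y \<subseteq> X - {\<sigma>}"
    using seg_subset_subtree[OF X] x y * seg_eq[OF T] by auto
  then show "connected_component (X - {\<sigma>}) x y"
    unfolding connected_component_def
    using is_segment_connected[OF seg] is_segment_endpoints[OF seg] by blast
qed

text \<open>The points of \<open>P\<close> lie in pairwise distinct components after the removal of \<open>\<sigma>\<close>.\<close>

definition separated :: "'a \<Rightarrow> 'a set \<Rightarrow> bool" where
  "separated \<sigma> P \<longleftrightarrow> \<sigma> \<notin> P \<and> pairwise (\<lambda>x y. btw x \<sigma> y) P"

lemma separated_finite:
  assumes X: "subtree X" and \<sigma>: "\<sigma> \<in> T" and P: "P \<subseteq> X" "separated \<sigma> P"
    and fin: "tree_degree \<sigma> X < \<infinity>"
  shows "finite P" "enat (card P) \<le> tree_degree \<sigma> X"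
proof -
  let ?c = "connected_component_set (X - {\<sigma>})"
  have sub: "P \<subseteq> X - {\<sigma>}" using P unfolding separated_def by auto
  have inj: "inj_on ?c P"
  proof (rule inj_onI)
    fix x y assume xy: "x \<in> P" "y \<in> P" "?c x = ?c y"
    then have "connected_component (X - {\<sigma>}) x y"
      using sub by (metis connected_component_refl mem_Collect_eq subsetD)
    then have "\<not> btw x \<sigma> y"
      using connected_component_iff[OF X \<sigma>] xy sub by blast
    then show "x = y"
      using P(2) xy(1,2) unfolding separated_def pairwise_def by blast
  qed
  have img: "?c ` P \<subseteq> components (X - {\<sigma>})" using sub unfolding components_def by blast
  have f: "finite (components (X - {\<sigma>}))"
    using fin unfolding tree_degree_def by (simp split: if_splits)
  show "finite P" using inj img f by (meson finite_imageD finite_subset)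
  show "enat (card P) \<le> tree_degree \<sigma> X"
    using card_mono[OF f img] card_image[OF inj] f unfolding tree_degree_def by simp
qed

text \<open>\<open>P\<close> is a transversal of the components, one point from each.\<close>

lemma separated_representatives:
  assumes X: "subtree X" and \<sigma>: "\<sigma> \<in> T"
  obtains P where "P \<subseteq> X" "separated \<sigma> P"
    "tree_degree \<sigma> X = (if finite P then enat (card P) else \<infinity>)"
proof -
  let ?c = "connected_component_set (X - {\<sigma>})"
  have "components (X - {\<sigma>}) \<subseteq> ?c ` (X - {\<sigma>})" by (simp add: components_def)
  then obtain P where P: "P \<subseteq> X - {\<sigma>}" "components (X - {\<sigma>}) = ?c ` P" "inj_on ?c P"
    unfolding subset_image_inj by (elim exE conjE)
  have "btw x \<sigma> y" if "x \<in> P" "y \<in> P" "x \<noteq> y" for x y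
  proof (rule ccontr)
    assume "\<not> btw x \<sigma> y"
    then have "connected_component (X - {\<sigma>}) x y"
      using connected_component_iff[OF X \<sigma>] that P(1) by blast
    then have "?c x = ?c y" by (rule connected_component_eq[THEN sym, OF CollectI])
    then show False using that P(3) by (meson inj_onD)
  qed
  then have "separated \<sigma> P" using P(1) unfolding separated_def pairwise_def by blast
  moreover have "tree_degree \<sigma> X = (if finite P then enat (card P) else \<infinity>)"
    unfolding tree_degree_def P(2) finite_image_iff[OF P(3)] card_image[OF P(3)] ..
  ultimately show ?thesis using that P(1) by blast
qed

lemma not_btw_trans:
  assumes "\<sigma> \<in> T" "x \<in> T" "y \<in> T" "z \<in> T" "\<not> btw x \<sigma> y" "\<not> btw y \<sigma> z"
  shows "\<not> btw x \<sigma> z"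
  using btw_tri[OF assms(2,3,4,1)] assms(5,6) by blast

text \<open>\<open>f\<close> moves each point within its own side of \<open>\<sigma>\<close>, so
  points on different sides remain separated and in particular distinct.\<close>

lemma separated_image:
  assumes "\<sigma> \<in> T" "P \<subseteq> T" "separated \<sigma> P"
    and "\<forall>x\<in>P. f x \<in> T \<and> f x \<noteq> \<sigma> \<and> \<not> btw x \<sigma> (f x)"
  shows "inj_on f P" "separated \<sigma> (f ` P)"
    and "\<And>x y. x \<in> P \<Longrightarrow> y \<in> P \<Longrightarrow> x \<noteq> y \<Longrightarrow> btw (f x) \<sigma> (f y)"
proof -
  note f = assms(4)[rule_format]
  show *: "btw (f x) \<sigma> (f y)" if xy: "x \<in> P" "y \<in> P" "x \<noteq> y" for x y
  proof (rule ccontr)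
    have T: "x \<in> T" "y \<in> T" "f x \<in> T" "f y \<in> T" using assms(2) f xy by auto
    assume "\<not> btw (f x) \<sigma> (f y)"
    then have "\<not> btw x \<sigma> (f y)"
      using not_btw_trans[OF assms(1) T(1,3,4)] f[OF xy(1)] by blast
    moreover have "\<not> btw (f y) \<sigma> y"
      using f[OF xy(2)] btw_commute[of y \<sigma> "f y"] by blast
    ultimately have "\<not> btw x \<sigma> y" using not_btw_trans[OF assms(1) T(1,4,2)] by blast
    then show False using assms(3) xy unfolding separated_def pairwise_def by blast
  qed
  show "inj_on f P"
  proof (rule inj_onI, rule ccontr)
    fix x y assume "x \<in> P" "y \<in> P" "f x = f y" "x \<noteq> y"
    then show False using *[of x y] f[of x] by simp
  qed
  show "separated \<sigma> (f ` P)"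
    unfolding separated_def pairwise_image
  proof
    show "\<sigma> \<notin> f ` P" using f by blast
    show "pairwise (\<lambda>x y. f x \<noteq> f y \<longrightarrow> btw (f x) \<sigma> (f y)) P"
      using * by (simp add: pairwise_def)
  qed
qed

section \<open>Antichains and branch points\<close>

definition antichain :: "'a set \<Rightarrow> bool" where
  "antichain A \<longleftrightarrow> (\<forall>x\<in>A. \<forall>y\<in>A. x \<preceq> y \<longrightarrow> x = y)"

text \<open>The bound is uniform over all antichains, which is stronger than finiteness of each: an
  infinite set of branch points is refuted by finite antichains of growing size.\<close>

definition finite_width :: "'a set \<Rightarrow> bool" where
  "finite_width U \<longleftrightarrow> (\<exists>N. \<forall>A\<subseteq>U. finite A \<longrightarrow> antichain A \<longrightarrow> card A \<le> N)"

lemma antichain_subset: "antichain A \<Longrightarrow> B \<subseteq> A \<Longrightarrow> antichain B"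
  unfolding antichain_def by blast

lemma antichain_finite:
  assumes "finite_width U" "A \<subseteq> U" "antichain A"
  shows "finite A"
proof -
  obtain N where N: "\<And>A. A \<subseteq> U \<Longrightarrow> finite A \<Longrightarrow> antichain A \<Longrightarrow> card A \<le> N"
    using assms(1) unfolding finite_width_def by blast
  show ?thesis
  proof (rule ccontr)
    assume "infinite A"
    then obtain B where B: "B \<subseteq> A" "finite B" "card B = Suc N"
      using infinite_arbitrarily_large by blast
    then have "card B \<le> N" using N[of B] antichain_subset[OF assms(3)] assms(2) by blast
    then show False using B by simp
  qed
qed

text \<open>
  Induction: split the rest of \<open>B\<close> at its lowest point \<open>\<sigma>\<close> into the part in the direction of one
  branch \<open>u\<close> and the remaining part; an empty part contributes the branch itself.
\<close>

lemma fork_antichain: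
  assumes "finite B" "B \<noteq> {}" "B \<subseteq> T" "U \<subseteq> T"
    and "\<And>b. b \<in> B \<Longrightarrow> \<exists>u\<in>U. \<exists>v\<in>U. b \<preceq> u \<and> b \<preceq> v \<and> u \<noteq> b \<and> v \<noteq> b \<and> btw u b v"
  shows "\<exists>A\<subseteq>U. finite A \<and> antichain A \<and> card A = Suc (card B) \<and>
    (\<forall>a\<in>A. \<exists>b\<in>B. b \<preceq> a \<and> b \<noteq> a)"
  using assms(1-3,5)
proof (induction B rule: finite_psubset_induct)
  case (psubset B)
  \<comment> \<open>Minimal height ensures that no other point of \<open>B\<close> lies below
    \<open>\<sigma>\<close>.\<close>
  define \<sigma> where "\<sigma> = arg_min_on (dist \<rho>) B"
  have \<sigma>B: "\<sigma> \<in> B"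
    unfolding \<sigma>_def by (rule arg_min_if_finite(1)[OF psubset.hyps psubset.prems(1)])
  have min: "dist \<rho> \<sigma> \<le> dist \<rho> b" if "b \<in> B" for b
    unfolding \<sigma>_def by (rule arg_min_least[OF psubset.hyps psubset.prems(1) that])
  have \<sigma>T: "\<sigma> \<in> T" using \<sigma>B psubset.prems(2) by blast
  obtain u v where uv: "u \<in> U" "v \<in> U" "\<sigma> \<preceq> u" "\<sigma> \<preceq> v" "u \<noteq> \<sigma>" "v \<noteq> \<sigma>" "btw u \<sigma> v"
    using psubset.prems(3)[OF \<sigma>B] by blast
  have uvT: "u \<in> T" "v \<in> T" using uv assms(4) by auto
  \<comment> \<open>A point \<open>a\<close> above \<open>c\<close> lies on the same side of
    \<open>\<sigma>\<close> as \<open>c\<close>. This is \<open>not_btw_above\<close> if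
    \<open>c\<close> is above \<open>\<sigma>\<close>; otherwise a separating
    \<open>\<sigma>\<close> would be below \<open>a\<close> and hence above \<open>c\<close>,
    against minimality.\<close>
  have side: "\<not> btw c \<sigma> a" if c: "c \<in> B \<union> {u, v}" "c \<noteq> \<sigma>" "c \<preceq> a" "a \<in> T" for c a
  proof
    assume *: "btw c \<sigma> a"
    have cT: "c \<in> T" using c psubset.prems(2) uvT by blast
    have "\<sigma> \<preceq> c"
    proof (rule ccontr)
      assume n: "\<not> \<sigma> \<preceq> c"
      then have "c \<in> B" using c uv by blast
      have "\<sigma> \<preceq> a" using btw_imp_below[OF cT c(4) \<sigma>T *] n by blast
      then have "c \<preceq> \<sigma>" using below_linear[OF cT \<sigma>T c(4) c(3)] n by blast
      then have "dist c \<sigma> \<le> 0" using min[OF \<open>c \<in> B\<close>] unfolding btw_def by linarith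
      then show False using c(2) by simp
    qed
    then show False using not_btw_above[OF _ c(3)] c(2) * by blast
  qed
  \<comment> \<open>\<open>B1\<close> consists of the points in the direction of \<open>u\<close>;
    \<open>B2\<close> takes all other directions, including points of \<open>B\<close> that are not
    above \<open>\<sigma>\<close>.\<close>
  define B1 where "B1 = {b \<in> B. b \<noteq> \<sigma> \<and> \<not> btw u \<sigma> b}"
  define B2 where "B2 = {b \<in> B. b \<noteq> \<sigma> \<and> btw u \<sigma> b}"
  \<comment> \<open>The induction hypothesis requires a nonempty set, so an empty part contributes
    the single point \<open>w\<close>. Recording a point of \<open>insert w B'\<close> below each
    \<open>a\<close> later tells on which side of \<open>\<sigma>\<close> it lies.\<close>
  have part: "\<exists>A\<subseteq>U. finite A \<and> antichain A \<and> card A = Suc (card B') \<and>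
      (\<forall>a\<in>A. (\<exists>c\<in>insert w B'. c \<preceq> a) \<and> (\<exists>b\<in>B. b \<preceq> a \<and> b \<noteq> a))"
    if B': "B' \<subset> B" and "w \<in> U" "\<sigma> \<preceq> w" "w \<noteq> \<sigma>" for B' w
  proof (cases "B' = {}")
    case True
    have "\<sigma> \<preceq> w \<and> \<sigma> \<noteq> w" using that by simp
    then show ?thesis
      using True that(2) \<sigma>B by (intro exI[of _ "{w}"]) (auto simp: antichain_def)
  next
    case False
    have "B' \<subseteq> T" using B' psubset.prems(2) by blast
    moreover have "\<exists>u\<in>U. \<exists>v\<in>U. b \<preceq> u \<and> b \<preceq> v \<and> u \<noteq> b \<and> v \<noteq> b \<and> btw u b v"
      if "b \<in> B'" for b
      using psubset.prems(3)[of b] that B' by (simp add: psubset_eq subset_iff)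
    ultimately obtain A where A: "A \<subseteq> U" "finite A" "antichain A" "card A = Suc (card B')"
        "\<forall>a\<in>A. \<exists>b\<in>B'. b \<preceq> a \<and> b \<noteq> a"
      using psubset.IH[OF B' False] by (elim meta_impE exE conjE)
    have "\<forall>a\<in>A. (\<exists>c\<in>insert w B'. c \<preceq> a) \<and> (\<exists>b\<in>B. b \<preceq> a \<and> b \<noteq> a)"
    proof
      fix a assume "a \<in> A"
      then obtain b where "b \<in> B'" "b \<preceq> a" "b \<noteq> a" using A(5) by blast
      then show "(\<exists>c\<in>insert w B'. c \<preceq> a) \<and> (\<exists>b\<in>B. b \<preceq> a \<and> b \<noteq> a)"
        using that(1) by blast
    qed
    then show ?thesis using A(1-4) by blast
  qed
  have "B1 \<subset> B" "B2 \<subset> B" using \<sigma>B unfolding B1_def B2_def by blast+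
  note ex = part[OF this(1) uv(1,3,5)] part[OF this(2) uv(2,4,6)]
  obtain A1 where
    A1: "A1 \<subseteq> U" "finite A1" "antichain A1" "card A1 = Suc (card B1)"
      "\<forall>a\<in>A1. (\<exists>c\<in>insert u B1. c \<preceq> a) \<and> (\<exists>b\<in>B. b \<preceq> a \<and> b \<noteq> a)"
    using ex(1) by (elim exE conjE)
  obtain A2 where
    A2: "A2 \<subseteq> U" "finite A2" "antichain A2" "card A2 = Suc (card B2)"
      "\<forall>a\<in>A2. (\<exists>c\<in>insert v B2. c \<preceq> a) \<and> (\<exists>b\<in>B. b \<preceq> a \<and> b \<noteq> a)"
    using ex(2) by (elim exE conjE)
  have above1: "\<not> btw u \<sigma> a" if "c \<in> insert u B1" "c \<preceq> a" "a \<in> T" for c a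
  proof -
    have c: "c \<in> B \<union> {u, v}" "c \<noteq> \<sigma>" "\<not> btw u \<sigma> c" "c \<in> T"
      using that(1) uv psubset.prems(2) uvT unfolding B1_def by auto
    then show ?thesis
      using not_btw_trans[OF \<sigma>T uvT(1) _ that(3)] side[OF c(1,2) that(2,3)] by blast
  qed
  have above2: "btw u \<sigma> a" if "c \<in> insert v B2" "c \<preceq> a" "a \<in> T" for c a
  proof (rule ccontr)
    have c: "c \<in> B \<union> {u, v}" "c \<noteq> \<sigma>" "btw u \<sigma> c" "c \<in> T"
      using that(1) uv psubset.prems(2) uvT unfolding B2_def by auto
    assume "\<not> btw u \<sigma> a"
    then show False
      using not_btw_trans[OF \<sigma>T uvT(1) that(3) c(4)] side[OF c(1,2) that(2,3)] c(3)
        btw_commute[of c \<sigma> a] by blast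
  qed
  \<comment> \<open>If \<open>x\<close> and \<open>y\<close> were comparable, the upper one would
    lie above a point of either part and so be on both sides of \<open>\<sigma>\<close>.\<close>
  have incomp: "\<not> x \<preceq> y \<and> \<not> y \<preceq> x" if xy: "x \<in> A1" "y \<in> A2" for x y
  proof -
    obtain c d where c: "c \<in> insert u B1" "c \<preceq> x" and d: "d \<in> insert v B2" "d \<preceq> y"
      using A1(5) A2(5) xy by blast
    have T: "x \<in> T" "y \<in> T" using xy A1(1) A2(1) assms(4) by auto
    show ?thesis
      using above1[OF c(1) below_trans[OF c(2)] T(2)] above2[OF d T(2)]
        above1[OF c T(1)] above2[OF d(1) below_trans[OF d(2)] T(1)] by blast
  qed
  have "A1 \<inter> A2 = {}" using incomp by fastforce
  have "B = insert \<sigma> (B1 \<union> B2)" "\<sigma> \<notin> B1 \<union> B2" "B1 \<inter> B2 = {}" "finite B1" "finite B2"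
    using \<sigma>B psubset.hyps unfolding B1_def B2_def by auto
  then have "card B = Suc (card B1 + card B2)" by (simp add: card_Un_disjoint)
  \<comment> \<open>Each part gains one point while \<open>\<sigma>\<close> is lost from the count,
    which leaves a net gain of one.\<close>
  then have "card (A1 \<union> A2) = Suc (card B)"
    using card_Un_disjoint[OF A1(2) A2(2) \<open>A1 \<inter> A2 = {}\<close>] A1(4) A2(4) by simp
  moreover have "antichain (A1 \<union> A2)"
    using A1(3) A2(3) incomp unfolding antichain_def by blast
  ultimately show ?case using A1(1,2,5) A2(1,2,5) by (intro exI[of _ "A1 \<union> A2"]) auto
qed

section \<open>Degrees and branch points of one subtree relative to another\<close>

text \<open>For \<open>\<sigma>\<close> outside \<open>S\<close>, no point of \<open>S\<close> is
  above \<open>\<sigma>\<close>, so all of \<open>S\<close> lies on one side of it and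
  \<open>P\<close> has at most one element.\<close>

lemma separated_finite_subtree:
  assumes S: "subtree S" and \<sigma>: "\<sigma> \<in> T" and fin: "\<sigma> \<in> S \<Longrightarrow> tree_degree \<sigma> S < \<infinity>"
    and P: "P \<subseteq> S" "separated \<sigma> P"
  shows "finite P"
proof (cases "\<sigma> \<in> S")
  case True
  then show ?thesis using separated_finite(1)[OF S \<sigma> P] fin by blast
next
  case False
  have "x = y" if xy: "x \<in> P" "y \<in> P" for x y
  proof (rule ccontr)
    assume "x \<noteq> y"
    then have "btw x \<sigma> y" using P(2) xy unfolding separated_def pairwise_def by blast
    moreover have "x \<in> T" "y \<in> T" using xy P(1) subtreeD(2)[OF S] by auto
    ultimately have "\<sigma> \<preceq> x \<or> \<sigma> \<preceq> y" using btw_imp_below \<sigma> by blast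
    then show False using False subtreeD(3)[OF S _ \<sigma>] xy P(1) by blast
  qed
  then show ?thesis by (metis finite.simps insertI1 is_singletonI' is_singleton_def)
qed

text \<open>The hypothesis says that the branch of \<open>x\<close> at \<open>\<sigma>\<close>
  contains no point of \<open>S\<close>. Moving down this branch gives a point of bounded height
  that inherits the property.\<close>

lemma stub_point:
  assumes R: "subtree R" and S: "subtree S" and \<sigma>: "\<sigma> \<in> T" and x: "x \<in> R" "x \<noteq> \<sigma>"
    and sep: "\<And>s. s \<in> S \<Longrightarrow> s \<noteq> \<sigma> \<Longrightarrow> btw x \<sigma> s"
  shows "\<exists>y\<in>R - S. \<sigma> \<preceq> y \<and> y \<noteq> \<sigma> \<and> \<not> btw x \<sigma> y \<and> dist \<rho> y \<le> dist \<rho> \<sigma> + 1 \<and>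
    (\<forall>s\<in>S. s \<noteq> \<sigma> \<longrightarrow> btw y \<sigma> s)"
proof -
  have xT: "x \<in> T" using x subtreeD(2)[OF R] by blast
  \<comment> \<open>The root belongs to \<open>S\<close>, so unless it equals
    \<open>\<sigma>\<close> it is separated from \<open>x\<close> by
    \<open>\<sigma>\<close>.\<close>
  have "\<sigma> \<preceq> x"
    using sep[OF subtreeD(1)[OF S]] btw_commute[of x \<sigma> \<rho>] by (cases "\<rho> = \<sigma>") auto
  then obtain y where y: "y \<in> T" "\<sigma> \<preceq> y" "y \<noteq> \<sigma>" "y \<preceq> x" "dist \<rho> y \<le> dist \<rho> \<sigma> + 1"
    using lower_point[OF \<sigma> xT] x by blast
  have n: "\<not> btw y \<sigma> x" using not_btw_above[OF y(2,4)] y(3) by blast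
  have s: "btw y \<sigma> s" if s: "s \<in> S" "s \<noteq> \<sigma>" for s
  proof -
    have "s \<in> T" using s subtreeD(2)[OF S] by blast
    then show ?thesis
      using btw_tri[OF xT y(1) _ \<sigma> sep[OF s]] n btw_commute[of x \<sigma> y] by blast
  qed
  \<comment> \<open>Otherwise \<open>y\<close> would be separated from itself by
    \<open>\<sigma>\<close>.\<close>
  have "y \<notin> S" using s[of y] y(3) by auto
  moreover have "y \<in> R" using subtreeD(3)[OF R x(1) y(1,4)] .
  moreover have "\<not> btw x \<sigma> y" using n btw_commute[of x \<sigma> y] by simp
  ultimately show ?thesis using y s by blast
qed

text \<open>The sides of \<open>\<sigma>\<close> that contain points of \<open>S\<close> are counted
  by the degree in \<open>S\<close>; every other side has a stub point, and these stubs form an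
  antichain outside \<open>S\<close>.\<close>

lemma tree_degree_finite:
  assumes R: "subtree R" and S: "subtree S" and \<sigma>: "\<sigma> \<in> T"
    and fin: "\<sigma> \<in> S \<Longrightarrow> tree_degree \<sigma> S < \<infinity>"
    and width: "finite_width ((R - S) \<inter> cball \<rho> (dist \<rho> \<sigma> + 1))"
  shows "tree_degree \<sigma> R < \<infinity>"
proof -
  obtain P where P: "P \<subseteq> R" "separated \<sigma> P"
    and deg: "tree_degree \<sigma> R = (if finite P then enat (card P) else \<infinity>)"
    using separated_representatives[OF R \<sigma>] .
  have PT: "P \<subseteq> T" using P(1) subtreeD(2)[OF R] by blast
  have ST: "S \<subseteq> T" using subtreeD(2)[OF S] .
  \<comment> \<open>These representatives share their side of \<open>\<sigma>\<close> with a point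
    of \<open>S\<close>.\<close>
  define P1 where "P1 = {x \<in> P. \<exists>s\<in>S. s \<noteq> \<sigma> \<and> \<not> btw x \<sigma> s}"
  have sub: "P1 \<subseteq> T" "P - P1 \<subseteq> T" using PT unfolding P1_def by auto
  have sep: "separated \<sigma> P1" "separated \<sigma> (P - P1)"
    using P(2) unfolding separated_def P1_def pairwise_def by auto
  have "\<forall>x\<in>P1. \<exists>s. s \<in> S \<and> s \<noteq> \<sigma> \<and> \<not> btw x \<sigma> s" unfolding P1_def by blast
  then obtain f where f: "\<And>x. x \<in> P1 \<Longrightarrow> f x \<in> S \<and> f x \<noteq> \<sigma> \<and> \<not> btw x \<sigma> (f x)"
    by (elim bchoice[THEN exE]) blast
  then have fT: "\<forall>x\<in>P1. f x \<in> T \<and> f x \<noteq> \<sigma> \<and> \<not> btw x \<sigma> (f x)" using ST by blast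
  note fi = separated_image[where f = f, OF \<sigma> sub(1) sep(1) fT]
  have "f ` P1 \<subseteq> S" using f by blast
  then have "finite (f ` P1)" using separated_finite_subtree[OF S \<sigma> fin] fi(2) by blast
  then have fin1: "finite P1" using fi(1) finite_imageD by blast
  have "\<forall>x\<in>P - P1. \<exists>y. y \<in> R - S \<and> \<sigma> \<preceq> y \<and> y \<noteq> \<sigma> \<and> \<not> btw x \<sigma> y \<and>
      dist \<rho> y \<le> dist \<rho> \<sigma> + 1"
  proof
    fix x assume x: "x \<in> P - P1"
    then have "x \<in> R" "x \<noteq> \<sigma>" using P unfolding separated_def by auto
    moreover have "btw x \<sigma> s" if "s \<in> S" "s \<noteq> \<sigma>" for s
      using x that unfolding P1_def by blast
    ultimately show "\<exists>y. y \<in> R - S \<and> \<sigma> \<preceq> y \<and> y \<noteq> \<sigma> \<and> \<not> btw x \<sigma> y \<and>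
        dist \<rho> y \<le> dist \<rho> \<sigma> + 1"
      using stub_point[OF R S \<sigma>, of x] by blast
  qed
  then obtain g where g: "\<And>x. x \<in> P - P1 \<Longrightarrow> g x \<in> R - S \<and> \<sigma> \<preceq> g x \<and> g x \<noteq> \<sigma> \<and>
      \<not> btw x \<sigma> (g x) \<and> dist \<rho> (g x) \<le> dist \<rho> \<sigma> + 1"
    by (elim bchoice[THEN exE]) blast
  then have gT: "\<forall>x\<in>P - P1. g x \<in> T \<and> g x \<noteq> \<sigma> \<and> \<not> btw x \<sigma> (g x)"
    using subtreeD(2)[OF R] by blast
  note gi = separated_image[where f = g, OF \<sigma> sub(2) sep(2) gT]
  have "antichain (g ` (P - P1))"
    unfolding antichain_def
  proof (intro ballI impI, elim imageE, hypsubst)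
    fix x y assume xy: "x \<in> P - P1" "y \<in> P - P1" "g x \<preceq> g y"
    have "\<sigma> \<preceq> g x" "\<sigma> \<noteq> g x" using g[OF xy(1)] by auto
    then have "\<not> btw (g x) \<sigma> (g y)" using not_btw_above xy(3) by blast
    then show "g x = g y" using gi(3)[OF xy(1,2)] by blast
  qed
  moreover have "g ` (P - P1) \<subseteq> (R - S) \<inter> cball \<rho> (dist \<rho> \<sigma> + 1)" using g by auto
  ultimately have "finite (g ` (P - P1))" using antichain_finite[OF width] by blast
  then have "finite (P - P1)" using gi(1) finite_imageD by blast
  then have "finite P" using fin1 by simp
  then show ?thesis using deg by simp
qed

lemma separated_card3:
  assumes R: "subtree R" and \<sigma>: "\<sigma> \<in> T" and deg: "tree_degree \<sigma> R \<ge> 3"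
  obtains P where "P \<subseteq> R" "separated \<sigma> P" "finite P" "card P = 3"
proof -
  obtain Q where Q: "Q \<subseteq> R" "separated \<sigma> Q"
    and d: "tree_degree \<sigma> R = (if finite Q then enat (card Q) else \<infinity>)"
    using separated_representatives[OF R \<sigma>] .
  have "\<exists>P\<subseteq>Q. finite P \<and> card P = 3"
  proof (cases "finite Q")
    case True
    then have "3 \<le> card Q" using d deg by (simp add: numeral_eq_enat)
    then show ?thesis using obtain_subset_with_card_n[of 3 Q] finite_subset[OF _ True] by metis
  next
    case False
    then show ?thesis using infinite_arbitrarily_large[of Q 3] by blast
  qed
  then obtain P where P: "P \<subseteq> Q" "finite P" "card P = 3" by blast
  have "separated \<sigma> P"
    using Q(2) P(1) pairwise_subset unfolding separated_def by blast
  then show ?thesis using that P Q(1) by blast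
qed

text \<open>Two points not above \<open>\<sigma>\<close> are on the same side of it, namely that of
  the root. So at least two of three separated points are above \<open>\<sigma>\<close>, and both
  can be lowered.\<close>

lemma fork_at_branch_point:
  assumes R: "subtree R" and \<sigma>: "\<sigma> \<in> T" and deg: "tree_degree \<sigma> R \<ge> 3"
  shows "\<exists>u\<in>R. \<exists>v\<in>R. \<sigma> \<preceq> u \<and> \<sigma> \<preceq> v \<and> u \<noteq> \<sigma> \<and> v \<noteq> \<sigma> \<and> btw u \<sigma> v \<and>
    dist \<rho> u \<le> dist \<rho> \<sigma> + 1 \<and> dist \<rho> v \<le> dist \<rho> \<sigma> + 1"
proof -
  obtain P where P: "P \<subseteq> R" "separated \<sigma> P" "finite P" "card P = 3"
    using separated_card3[OF assms] .
  have PT: "P \<subseteq> T" using P(1) subtreeD(2)[OF R] by blast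
  define Q where "Q = {x \<in> P. \<sigma> \<preceq> x}"
  have "x = y" if xy: "x \<in> P - Q" "y \<in> P - Q" for x y
  proof (rule ccontr)
    assume "x \<noteq> y"
    then have "btw x \<sigma> y" using P(2) xy unfolding separated_def pairwise_def by blast
    moreover have "x \<in> T" "y \<in> T" using xy PT by auto
    ultimately have "\<sigma> \<preceq> x \<or> \<sigma> \<preceq> y" using btw_imp_below \<sigma> by blast
    then show False using xy unfolding Q_def by blast
  qed
  then have "card (P - Q) \<le> Suc 0" by (simp add: card_le_Suc0_iff_eq P(3))
  moreover have "card P = card Q + card (P - Q)"
    using card_Int_Diff[OF P(3), of Q] unfolding Q_def by (simp add: Int_absorb1)
  ultimately have "card Q \<noteq> 0" "card Q \<noteq> Suc 0" using P(4) by auto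
  then obtain x y where xy: "x \<in> Q" "y \<in> Q" "x \<noteq> y"
    by (metis card.empty card_1_singleton_iff equals0I insertI1 is_singletonI' is_singleton_def)
  have Q: "Q \<subseteq> T" "separated \<sigma> Q"
    using PT P(2) unfolding Q_def separated_def pairwise_def by auto
  have "\<forall>x\<in>Q. \<exists>z. z \<in> R \<and> \<sigma> \<preceq> z \<and> z \<noteq> \<sigma> \<and> \<not> btw x \<sigma> z \<and> dist \<rho> z \<le> dist \<rho> \<sigma> + 1"
  proof
    fix x assume x: "x \<in> Q"
    then have "x \<in> T" "x \<noteq> \<sigma>" "\<sigma> \<preceq> x" "x \<in> R"
      using Q P(1) unfolding Q_def separated_def by auto
    then obtain z where z: "z \<in> T" "\<sigma> \<preceq> z" "z \<noteq> \<sigma>" "z \<preceq> x" "dist \<rho> z \<le> dist \<rho> \<sigma> + 1"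
      using lower_point[OF \<sigma>] by blast
    have "\<not> btw z \<sigma> x" using not_btw_above[OF z(2,4)] z(3) by blast
    then have "\<not> btw x \<sigma> z" using btw_commute[of x \<sigma> z] by simp
    then show "\<exists>z. z \<in> R \<and> \<sigma> \<preceq> z \<and> z \<noteq> \<sigma> \<and> \<not> btw x \<sigma> z \<and> dist \<rho> z \<le> dist \<rho> \<sigma> + 1"
      using z subtreeD(3)[OF R \<open>x \<in> R\<close> z(1,4)] by blast
  qed
  then obtain f where f: "\<And>x. x \<in> Q \<Longrightarrow> f x \<in> R \<and> \<sigma> \<preceq> f x \<and> f x \<noteq> \<sigma> \<and> \<not> btw x \<sigma> (f x) \<and>
      dist \<rho> (f x) \<le> dist \<rho> \<sigma> + 1"
    by (elim bchoice[THEN exE]) blast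
  then have "\<forall>x\<in>Q. f x \<in> T \<and> f x \<noteq> \<sigma> \<and> \<not> btw x \<sigma> (f x)"
    using subtreeD(2)[OF R] by blast
  from separated_image(3)[where f = f, OF \<sigma> Q this xy] f[OF xy(1)] f[OF xy(2)]
  show ?thesis by blast
qed

text \<open>Forks at points outside \<open>S\<close> stay outside \<open>S\<close> by closure under
  predecessors, so \<open>N + 1\<close> branch points would yield an antichain of
  \<open>N + 2\<close> points.\<close>

lemma finite_branch_points_outside:
  assumes R: "subtree R" and S: "subtree S" and width: "finite_width ((R - S) \<inter> cball \<rho> (r + 1))"
  shows "finite (branch_points R \<rho> \<inter> cball \<rho> r - S)"
proof -
  let ?U = "(R - S) \<inter> cball \<rho> (r + 1)"
  obtain N where N: "\<And>A. A \<subseteq> ?U \<Longrightarrow> finite A \<Longrightarrow> antichain A \<Longrightarrow> card A \<le> N"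
    using width unfolding finite_width_def by blast
  have RT: "R \<subseteq> T" using subtreeD(2)[OF R] .
  show ?thesis
  proof (rule ccontr)
    assume inf: "infinite (branch_points R \<rho> \<inter> cball \<rho> r - S)"
    obtain B where B: "B \<subseteq> branch_points R \<rho> \<inter> cball \<rho> r - S" "finite B" "card B = Suc N"
      using infinite_arbitrarily_large[OF inf, of "Suc N"] by blast
    have "\<exists>u\<in>?U. \<exists>v\<in>?U. b \<preceq> u \<and> b \<preceq> v \<and> u \<noteq> b \<and> v \<noteq> b \<and> btw u b v" if "b \<in> B" for b
    proof -
      have b: "b \<in> T" "b \<notin> S" "dist \<rho> b \<le> r" "tree_degree b R \<ge> 3"
        using B(1) that RT unfolding branch_points_def by auto
      obtain u v where uv: "u \<in> R" "v \<in> R" "b \<preceq> u" "b \<preceq> v" "u \<noteq> b" "v \<noteq> b" "btw u b v"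
        "dist \<rho> u \<le> dist \<rho> b + 1" "dist \<rho> v \<le> dist \<rho> b + 1"
        using fork_at_branch_point[OF R b(1,4)] by blast
      have "u \<notin> S" "v \<notin> S" using subtreeD(3)[OF S _ b(1)] uv(3,4) b(2) by blast+
      then have "u \<in> ?U" "v \<in> ?U" using uv b(3) by auto
      then show ?thesis using uv(3-7) by blast
    qed
    moreover have "B \<noteq> {}" "B \<subseteq> T" "?U \<subseteq> T" using B RT unfolding branch_points_def by auto
    ultimately obtain A where "A \<subseteq> ?U" "finite A" "antichain A" "card A = Suc (card B)"
      using fork_antichain[OF B(2), of ?U] by blast
    then show False using N[of A] B(3) by simp
  qed
qed

text \<open>Each such point carries a branch of \<open>R\<close> that avoids \<open>S\<close>.
  Choosing a stub on each branch maps these points injectively onto an antichain.\<close>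

lemma finite_new_branch_points:
  assumes R: "subtree R" and S: "subtree S" and width: "finite_width ((R - S) \<inter> cball \<rho> (r + 1))"
  shows "finite {\<sigma> \<in> branch_points R \<rho> \<inter> cball \<rho> r \<inter> S. \<sigma> \<notin> branch_points S \<rho>}" (is "finite ?C")
proof -
  have ST: "S \<subseteq> T" using subtreeD(2)[OF S] .
  have "\<forall>\<sigma>\<in>?C. \<exists>y. y \<in> R - S \<and> \<sigma> \<preceq> y \<and> y \<noteq> \<sigma> \<and> dist \<rho> y \<le> dist \<rho> \<sigma> + 1 \<and>
      (\<forall>s\<in>S. s \<noteq> \<sigma> \<longrightarrow> btw y \<sigma> s)"
  proof
    fix \<sigma> assume "\<sigma> \<in> ?C"
    then have \<sigma>: "\<sigma> \<in> T" and R3: "tree_degree \<sigma> R \<ge> 3" and S3: "tree_degree \<sigma> S < 3"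
      using ST unfolding branch_points_def by auto
    obtain P where P: "P \<subseteq> R" "separated \<sigma> P" "finite P" "card P = 3"
      using separated_card3[OF R \<sigma> R3] .
    have PT: "P \<subseteq> T" using P(1) subtreeD(2)[OF R] by blast
    \<comment> \<open>If all three sides contained points of \<open>S\<close>, then
      \<open>\<sigma>\<close> would have degree at least 3 in \<open>S\<close>.\<close>
    have "\<exists>x\<in>P. \<forall>s. s \<in> S \<longrightarrow> s \<noteq> \<sigma> \<longrightarrow> btw x \<sigma> s"
    proof (rule ccontr)
      assume "\<not> ?thesis"
      then have "\<forall>x\<in>P. \<exists>s. s \<in> S \<and> s \<noteq> \<sigma> \<and> \<not> btw x \<sigma> s" by blast
      then obtain f where f: "\<And>x. x \<in> P \<Longrightarrow> f x \<in> S \<and> f x \<noteq> \<sigma> \<and> \<not> btw x \<sigma> (f x)"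
        by (elim bchoice[THEN exE]) blast
      then have fT: "\<forall>x\<in>P. f x \<in> T \<and> f x \<noteq> \<sigma> \<and> \<not> btw x \<sigma> (f x)" using ST by blast
      note fi = separated_image[where f = f, OF \<sigma> PT P(2) fT]
      have "f ` P \<subseteq> S" using f by blast
      moreover have "tree_degree \<sigma> S < \<infinity>"
        using S3 by (metis enat_ord_code(4) numeral_eq_enat order_less_trans)
      ultimately have "enat (card (f ` P)) \<le> tree_degree \<sigma> S"
        using separated_finite(2)[OF S \<sigma> _ fi(2)] by blast
      then have "enat 3 < 3" using S3 card_image[OF fi(1)] P(4) by simp
      then show False by (simp add: numeral_eq_enat)
    qed
    then obtain x where x: "x \<in> P" "\<And>s. s \<in> S \<Longrightarrow> s \<noteq> \<sigma> \<Longrightarrow> btw x \<sigma> s" by blast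
    have "x \<in> R" "x \<noteq> \<sigma>" using x(1) P unfolding separated_def by auto
    then show "\<exists>y. y \<in> R - S \<and> \<sigma> \<preceq> y \<and> y \<noteq> \<sigma> \<and> dist \<rho> y \<le> dist \<rho> \<sigma> + 1 \<and>
        (\<forall>s\<in>S. s \<noteq> \<sigma> \<longrightarrow> btw y \<sigma> s)"
      using stub_point[OF R S \<sigma> _ _ x(2)] by blast
  qed
  then obtain g where g: "\<And>\<sigma>. \<sigma> \<in> ?C \<Longrightarrow> g \<sigma> \<in> R - S \<and> \<sigma> \<preceq> g \<sigma> \<and> g \<sigma> \<noteq> \<sigma> \<and>
      dist \<rho> (g \<sigma>) \<le> dist \<rho> \<sigma> + 1 \<and> (\<forall>s\<in>S. s \<noteq> \<sigma> \<longrightarrow> btw (g \<sigma>) \<sigma> s)"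
    by (elim bchoice[THEN exE]) blast
  have CT: "\<sigma> \<in> T" "\<sigma> \<in> S" "dist \<rho> \<sigma> \<le> r" if "\<sigma> \<in> ?C" for \<sigma>
    using that ST by auto
  have gT: "g \<sigma> \<in> T" if "\<sigma> \<in> ?C" for \<sigma> using g[OF that] subtreeD(2)[OF R] by blast
  \<comment> \<open>Both \<open>\<sigma>\<close> and \<open>\<tau>\<close> are below
    \<open>g \<tau>\<close>. The stub of \<open>\<tau>\<close> excludes
    \<open>\<tau> \<preceq> \<sigma>\<close>; then \<open>\<sigma> \<preceq> \<tau>\<close>, and
    since \<open>g \<sigma>\<close> and \<open>\<tau>\<close> are comparable they share a side of
    \<open>\<sigma>\<close>, which the stub of \<open>\<sigma>\<close> forbids. This gives both
    injectivity and the antichain property.\<close>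
  have key: "\<sigma> = \<tau>" if C: "\<sigma> \<in> ?C" "\<tau> \<in> ?C" and le: "g \<sigma> \<preceq> g \<tau>" for \<sigma> \<tau>
  proof (rule ccontr)
    assume ne: "\<sigma> \<noteq> \<tau>"
    have g\<sigma>: "\<sigma> \<preceq> g \<sigma>" "g \<sigma> \<noteq> \<sigma>" "btw (g \<sigma>) \<sigma> \<tau>"
      using g[OF C(1)] CT(2)[OF C(2)] ne by simp_all
    have g\<tau>: "\<tau> \<preceq> g \<tau>" "g \<tau> \<noteq> \<tau>" "btw (g \<tau>) \<tau> \<sigma>"
      using g[OF C(2)] CT(2)[OF C(1)] ne by simp_all
    have "\<sigma> \<preceq> g \<tau>" using below_trans[OF g\<sigma>(1) le] .
    then have "\<not> \<tau> \<preceq> \<sigma>"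
      using not_btw_above[of \<tau> \<sigma> "g \<tau>"] ne g\<tau>(3) btw_commute[of "g \<tau>" \<tau> \<sigma>] by blast
    then have "\<sigma> \<preceq> \<tau>"
      using below_linear[OF CT(1)[OF C(1)] CT(1)[OF C(2)] gT[OF C(2)] \<open>\<sigma> \<preceq> g \<tau>\<close> g\<tau>(1)] by blast
    have "g \<sigma> \<preceq> \<tau> \<or> \<tau> \<preceq> g \<sigma>"
      using below_linear[OF gT[OF C(1)] CT(1)[OF C(2)] gT[OF C(2)] le g\<tau>(1)] .
    then show False
      using not_btw_above[OF g\<sigma>(1) _ g\<sigma>(2)[symmetric], of \<tau>] not_btw_above[OF \<open>\<sigma> \<preceq> \<tau>\<close> _ ne, of "g \<sigma>"]
        g\<sigma>(3) btw_commute[of "g \<sigma>" \<sigma> \<tau>] by blast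
  qed
  have "antichain (g ` ?C)"
    unfolding antichain_def
  proof (intro ballI impI, elim imageE, hypsubst)
    fix \<sigma> \<tau> assume "\<sigma> \<in> ?C" "\<tau> \<in> ?C" "g \<sigma> \<preceq> g \<tau>"
    then have "\<sigma> = \<tau>" by (rule key)
    then show "g \<sigma> = g \<tau>" by simp
  qed
  moreover have "g ` ?C \<subseteq> (R - S) \<inter> cball \<rho> (r + 1)"
  proof (intro image_subsetI)
    fix \<sigma> assume "\<sigma> \<in> ?C"
    then show "g \<sigma> \<in> (R - S) \<inter> cball \<rho> (r + 1)" using g[of \<sigma>] CT(3)[of \<sigma>] by simp
  qed
  ultimately have "finite (g ` ?C)" using antichain_finite[OF width] by blast
  moreover have "inj_on g ?C"
  proof (rule inj_onI)
    fix \<sigma> \<tau> assume *: "\<sigma> \<in> ?C" "\<tau> \<in> ?C" "g \<sigma> = g \<tau>"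
    then show "\<sigma> = \<tau>" using key[OF *(1,2)] by simp
  qed
  ultimately show ?thesis by (rule finite_imageD)
qed

end

section \<open>Discreteness\<close>

lemma sum_enat_finite:
  fixes f :: "'b \<Rightarrow> enat"
  assumes "finite A" "\<And>x. x \<in> A \<Longrightarrow> f x < \<infinity>"
  shows "sum f A < \<infinity>"
  using assms by (induction A rule: finite_induct) (auto simp: plus_eq_infty_iff_enat)

lemma sum_le_infsum_enat:
  fixes f :: "'b \<Rightarrow> enat"
  assumes "finite F" "F \<subseteq> A"
  shows "sum f F \<le> infsum f A"
  unfolding enat_infsum_eq_SUP(2) using assms by (intro SUP_upper) simp

lemma infsum_enat_finite_support:
  fixes f :: "'b \<Rightarrow> enat"
  assumes "infsum f A < \<infinity>" "\<And>x. x \<in> A \<Longrightarrow> 1 \<le> f x"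
  shows "finite A"
proof (rule ccontr)
  assume inf: "infinite A"
  obtain n where n: "infsum f A = enat n" using assms(1) by (cases "infsum f A") auto
  obtain F where F: "finite F" "card F = Suc n" "F \<subseteq> A"
    using infinite_arbitrarily_large[OF inf] by blast
  have "enat (card F) = (\<Sum>x\<in>F. 1)" by (simp add: of_nat_eq_enat)
  also have "\<dots> \<le> sum f F" using F(3) assms(2) by (intro sum_mono) blast
  also have "\<dots> \<le> enat n" using sum_le_infsum_enat[OF F(1,3), of f] n by simp
  finally show False using F(2) by simp
qed

text \<open>The definition controls the degree at the root and, as one term of a finite sum, at
  branch points; all remaining points have degree below 3.\<close>

lemma discrete_R_tree_degree_finite:
  assumes "discrete_R_tree X \<rho>" "\<sigma> \<in> X"
  shows "tree_degree \<sigma> X < \<infinity>"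
proof -
  have fin: "tree_degree \<rho> X < \<infinity>"
    "(\<Sum>\<^sub>\<infinity>\<tau>\<in>branch_points X \<rho> \<inter> cball \<rho> r. tree_degree \<tau> X) < \<infinity>" if "r > 0" for r
    using assms(1) that unfolding discrete_R_tree_def by (auto simp: plus_eq_infty_iff_enat)
  consider "\<sigma> = \<rho>" | "\<sigma> \<in> branch_points X \<rho>" "\<sigma> \<noteq> \<rho>" | "tree_degree \<sigma> X < 3"
    using assms(2) unfolding branch_points_def by fastforce
  then show ?thesis
  proof cases
    case 1
    then show ?thesis using fin(1)[of 1] by simp
  next
    case 2
    have "(\<Sum>\<tau>\<in>{\<sigma>}. tree_degree \<tau> X) \<le>
        (\<Sum>\<^sub>\<infinity>\<tau>\<in>branch_points X \<rho> \<inter> cball \<rho> (dist \<rho> \<sigma>). tree_degree \<tau> X)"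
      using 2 by (intro sum_le_infsum_enat) auto
    also have "\<dots> < \<infinity>" using 2 fin(2) by simp
    finally show ?thesis by simp
  next
    case 3
    then show ?thesis by (metis enat_ord_code(4) numeral_eq_enat order_less_trans)
  qed
qed

lemma discrete_R_tree_finite_branch_points:
  assumes "discrete_R_tree X \<rho>" "r > 0"
  shows "finite (branch_points X \<rho> \<inter> cball \<rho> r)"
proof (rule infsum_enat_finite_support)
  show "(\<Sum>\<^sub>\<infinity>\<tau>\<in>branch_points X \<rho> \<inter> cball \<rho> r. tree_degree \<tau> X) < \<infinity>"
    using assms unfolding discrete_R_tree_def by (auto simp: plus_eq_infty_iff_enat)
  fix \<sigma> assume "\<sigma> \<in> branch_points X \<rho> \<inter> cball \<rho> r"
  then have "3 \<le> tree_degree \<sigma> X" unfolding branch_points_def by simp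
  moreover have "(1::enat) \<le> 3" by (simp add: numeral_eq_enat one_enat_def)
  ultimately show "1 \<le> tree_degree \<sigma> X" by (rule order_trans[rotated])
qed

context rooted_R_tree
begin

text \<open>This is the skeleton of a finite measure.\<close>

lemma discrete_R_tree_singleton: "discrete_R_tree {\<rho>} \<rho>"
proof -
  have "subtree {\<rho>}" unfolding subtree_def using root_in by auto
  then have "R_tree {\<rho>} \<rho>" by (rule R_tree_subtree)
  then show ?thesis
    unfolding discrete_R_tree_def branch_points_def tree_degree_def
    by (simp add: compact_imp_complete)
qed

text \<open>The purely tree-theoretic half of the theorem: the measure will enter through the width
  bound and the completeness of \<open>R\<close>.\<close>

lemma discrete_R_tree_extend:
  assumes R: "subtree R" and S: "subtree S" and "complete R" and disc: "discrete_R_tree S \<rho>"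
    and width: "\<And>r. r > 0 \<Longrightarrow> finite_width ((R - S) \<inter> cball \<rho> r)"
  shows "discrete_R_tree R \<rho>"
  unfolding discrete_R_tree_def
proof (intro conjI allI impI)
  show "R_tree R \<rho>" using R_tree_subtree[OF R] .
  show "complete R" by fact
  have deg: "tree_degree \<sigma> R < \<infinity>" if "\<sigma> \<in> T" for \<sigma>
    using tree_degree_finite[OF R S that discrete_R_tree_degree_finite[OF disc]]
      width[of "dist \<rho> \<sigma> + 1"] by (simp add: add_nonneg_pos)
  fix r :: real assume r: "r > 0"
  have w: "finite_width ((R - S) \<inter> cball \<rho> (r + 1))" using width r by simp
  \<comment> \<open>A branch point of \<open>R\<close> is outside \<open>S\<close>, or is new at a
    point of \<open>S\<close>, or branches already in \<open>S\<close>; each kind is finite in the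
    ball for its own reason.\<close>
  have "branch_points R \<rho> \<inter> cball \<rho> r \<subseteq> (branch_points R \<rho> \<inter> cball \<rho> r - S) \<union>
      {\<sigma> \<in> branch_points R \<rho> \<inter> cball \<rho> r \<inter> S. \<sigma> \<notin> branch_points S \<rho>} \<union>
      (branch_points S \<rho> \<inter> cball \<rho> r)" by blast
  then have fin: "finite (branch_points R \<rho> \<inter> cball \<rho> r)"
    by (rule finite_subset) (simp only: finite_Un finite_branch_points_outside[OF R S w]
      finite_new_branch_points[OF R S w] discrete_R_tree_finite_branch_points[OF disc r] simp_thms)
  have "branch_points R \<rho> \<subseteq> T" using subtreeD(2)[OF R] unfolding branch_points_def by blast
  then have "(\<Sum>\<sigma>\<in>branch_points R \<rho> \<inter> cball \<rho> r. tree_degree \<sigma> R) < \<infinity>"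
    using sum_enat_finite[OF fin, of "\<lambda>\<sigma>. tree_degree \<sigma> R"] deg by blast
  then show "tree_degree \<rho> R +
      (\<Sum>\<^sub>\<infinity>\<sigma>\<in>branch_points R \<rho> \<inter> cball \<rho> r. tree_degree \<sigma> R) < \<infinity>"
    using deg[OF root_in] fin by (simp add: plus_eq_infty_iff_enat)
qed

end

section \<open>Mass bounds\<close>

text \<open>The assumptions on \<open>\<mu>\<close> collect what finite and discretely infinite
  measures have in common.\<close>

locale measured_R_tree = rooted_R_tree T \<rho>
  for T :: "'a::metric_space set" and \<rho> :: 'a +
  fixes \<mu> :: "'a measure" and h :: real
  assumes complete_T: "complete T"
    and sets_\<mu>: "sets \<mu> = sets (restrict_space borel T)"
    and finite_on_balls: "\<And>r. emeasure \<mu> (T \<inter> cball \<rho> r) < \<infinity>"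
    and complete_Skel: "complete (Skel T \<rho> \<mu>)"
    and finite_over_spheres:
      "\<And>r. r > 0 \<Longrightarrow> emeasure \<mu> (\<Union>\<sigma>\<in>sphere \<rho> r \<inter> finite_part T \<rho> \<mu>. fringe T \<rho> \<sigma>) < \<infinity>"
    and h_pos: "h > 0"
begin

abbreviation "S \<equiv> Skel T \<rho> \<mu>"
abbreviation "R \<equiv> mass_erased T \<rho> \<mu> h"

lemma closed_T: "closed T"
  using complete_T by (rule complete_imp_closed)

lemma closed_in_sets: "closed C \<Longrightarrow> C \<subseteq> T \<Longrightarrow> C \<in> sets \<mu>"
  unfolding sets_\<mu> sets_restrict_space by (intro image_eqI[of _ _ C]) auto

text \<open>Betweenness is an equation between continuous functions, so fringes are closed.\<close>

lemma fringe_in_sets: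
  assumes "\<sigma> \<in> T"
  shows "fringe T \<rho> \<sigma> \<in> sets \<mu>"
proof (rule closed_in_sets)
  have "closed {x. dist \<rho> \<sigma> + dist \<sigma> x = dist \<rho> x}"
    by (intro closed_Collect_eq continuous_intros)
  then have "closed (T \<inter> {x. dist \<rho> \<sigma> + dist \<sigma> x = dist \<rho> x})"
    using closed_T by (rule closed_Int[rotated])
  moreover have "fringe T \<rho> \<sigma> = T \<inter> {x. dist \<rho> \<sigma> + dist \<sigma> x = dist \<rho> x}"
    unfolding fringe_eq[OF assms] btw_def by blast
  ultimately show "closed (fringe T \<rho> \<sigma>)" by simp
  show "fringe T \<rho> \<sigma> \<subseteq> T" unfolding fringe_def by blast
qed

lemma emeasure_fringe_mono:
  assumes "x \<in> T" "y \<in> T" "x \<preceq> y"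
  shows "emeasure \<mu> (fringe T \<rho> y) \<le> emeasure \<mu> (fringe T \<rho> x)"
  using fringe_mono[OF assms] fringe_in_sets[OF assms(1)] by (rule emeasure_mono)

lemma below_root: "x \<preceq> \<rho> \<Longrightarrow> x = \<rho>"
  by simp

lemma subtree_Skel: "subtree S"
  unfolding subtree_def
proof (intro conjI ballI impI)
  show "\<rho> \<in> S" "S \<subseteq> T" using root_in unfolding Skel_def by auto
  show "x \<in> S" if "y \<in> S" "x \<in> T" "x \<preceq> y" for x y
    using that emeasure_fringe_mono[OF that(2) _ that(3)] below_root[of x]
    unfolding Skel_def by (auto simp: top_unique)
qed

lemma subtree_mass_erased: "subtree R"
  unfolding subtree_def
proof (intro conjI ballI impI)
  show "\<rho> \<in> R" "R \<subseteq> T" using root_in unfolding mass_erased_def by auto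
  show "x \<in> R" if "y \<in> R" "x \<in> T" "x \<preceq> y" for x y
    using that emeasure_fringe_mono[OF that(2) _ that(3)] below_root[of x] order_trans
    unfolding mass_erased_def by auto
qed

lemma Skel_subset_mass_erased: "S \<subseteq> R"
  unfolding Skel_def mass_erased_def by auto

section \<open>Measurability over spheres and the width bound\<close>

lemma ancestor_at_height:
  assumes "z \<in> T" "0 \<le> r" "r \<le> dist \<rho> z"
  obtains p where "p \<in> T" "p \<preceq> z" "dist \<rho> p = r"
  using ex_point[OF root_in assms] by blast

text \<open>
  Needed because \<^const>\<open>emeasure\<close> is 0 on non-measurable sets, which would make the hypothesis
  \<open>finite_over_spheres\<close> void.
\<close>

lemma over_sphere_in_sets:
  "(\<Union>\<sigma>\<in>sphere \<rho> r \<inter> finite_part T \<rho> \<mu>. fringe T \<rho> \<sigma>) \<in> sets \<mu>" (is "?W \<in> _") if "r > 0"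
proof -
  define D where "D = T \<inter> {z. r \<le> dist \<rho> z}"
  \<comment> \<open>\<open>K\<close> collects the points of \<open>D\<close> whose ancestor at
    height \<open>r\<close> is in the skeleton; the set in question is \<open>D - K\<close>, a
    difference of closed sets.\<close>
  define K where "K = {z \<in> D. \<exists>s\<in>S. dist \<rho> s = r \<and> s \<preceq> z}"
  have ST: "S \<subseteq> T" using subtreeD(2)[OF subtree_Skel] .
  have same: "x = y" if "x \<in> T" "y \<in> T" "z \<in> T" "x \<preceq> z" "y \<preceq> z" "dist \<rho> x = dist \<rho> y" for x y z
    using dist_height_le[OF that(1,2,3,3,4,5,6)] by simp
  have "closed {z. r \<le> dist \<rho> z}" by (intro closed_Collect_le continuous_intros)
  then have D: "closed D" unfolding D_def using closed_T by (rule closed_Int[rotated])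
  have K: "closed K"
    unfolding closed_sequential_limits
  proof (intro allI impI, elim conjE)
    fix z l assume z: "\<forall>n. z n \<in> K" and lim: "z \<longlonglongrightarrow> l"
    have "l \<in> D" using closed_sequentially[OF D _ lim] z unfolding K_def by blast
    then have l: "l \<in> T" "r \<le> dist \<rho> l" unfolding D_def by auto
    obtain p where p: "p \<in> T" "p \<preceq> l" "dist \<rho> p = r"
      using ancestor_at_height[OF l(1) _ l(2)] \<open>r > 0\<close> by auto
    have "\<forall>n. \<exists>s. s \<in> S \<and> dist \<rho> s = r \<and> s \<preceq> z n" using z unfolding K_def by blast
    then obtain s where s: "\<And>n. s n \<in> S \<and> dist \<rho> (s n) = r \<and> s n \<preceq> z n"
      by (elim choice[THEN exE]) blast
    \<comment> \<open>By the Lipschitz bound the ancestors \<open>s n\<close> converge to the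
      ancestor \<open>p\<close> of the limit, which is then in the closed set
      \<open>S\<close>.\<close>
    have close: "dist (s n) p \<le> dist (z n) l" for n
    proof (rule dist_height_le)
      show "z n \<in> T" using z unfolding K_def D_def by blast
    qed (use s ST p l in auto)
    have "(\<lambda>n. dist (z n) l) \<longlonglongrightarrow> 0" using lim by (rule tendsto_dist_iff[THEN iffD1])
    then have "(\<lambda>n. dist (s n) p) \<longlonglongrightarrow> 0"
      by (rule Lim_null_comparison[OF always_eventually, rotated]) (simp add: close)
    then have "s \<longlonglongrightarrow> p" by (rule tendsto_dist_iff[THEN iffD2])
    then have "p \<in> S"
      using closed_sequentially[OF complete_imp_closed[OF complete_Skel], of s p] s by blast
    then show "l \<in> K" using \<open>l \<in> D\<close> p unfolding K_def by blast
  qed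
  have "?W = D - K"
  proof (intro equalityI subsetI)
    fix z assume "z \<in> ?W"
    then obtain \<sigma> where \<sigma>: "\<sigma> \<in> T" "\<sigma> \<notin> S" "dist \<rho> \<sigma> = r" "z \<in> T" "\<sigma> \<preceq> z"
      unfolding finite_part_def by (auto simp: fringe_eq)
    have "z \<in> D" using below_dist[OF \<sigma>(5)] \<sigma>(3,4) unfolding D_def by simp
    moreover have "z \<notin> K"
    proof
      assume "z \<in> K"
      then obtain s where "s \<in> S" "dist \<rho> s = r" "s \<preceq> z" unfolding K_def by blast
      then show False using same[OF \<sigma>(1) _ \<sigma>(4,5), of s] \<sigma>(2,3) ST by auto
    qed
    ultimately show "z \<in> D - K" by simp
  next
    fix z assume z: "z \<in> D - K"
    then have "z \<in> T" "r \<le> dist \<rho> z" unfolding D_def by auto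
    then obtain p where p: "p \<in> T" "p \<preceq> z" "dist \<rho> p = r"
      using ancestor_at_height[of z r] \<open>r > 0\<close> by auto
    then have "p \<notin> S" using z unfolding K_def by blast
    then have "p \<in> sphere \<rho> r \<inter> finite_part T \<rho> \<mu>" "z \<in> fringe T \<rho> p"
      using p \<open>z \<in> T\<close> unfolding finite_part_def by (auto simp: fringe_eq)
    then show "z \<in> ?W" by blast
  qed
  moreover have "D \<in> sets \<mu>" "K \<in> sets \<mu>"
    using D K by (auto intro!: closed_in_sets simp: D_def K_def)
  ultimately show ?thesis by simp
qed

lemma finite_width_outside_Skel:
  assumes r: "r > 0"
  shows "finite_width ((R - S) \<inter> cball \<rho> r)"
proof -
  let ?W = "\<Union>\<sigma>\<in>sphere \<rho> r \<inter> finite_part T \<rho> \<mu>. fringe T \<rho> \<sigma>"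
  let ?V = "(T \<inter> cball \<rho> r) \<union> ?W"
  have B: "T \<inter> cball \<rho> r \<in> sets \<mu>" using closed_T by (intro closed_in_sets) auto
  have V: "?V \<in> sets \<mu>" using B over_sphere_in_sets[OF r] by (rule sets.Un)
  have "emeasure \<mu> ?V \<le> emeasure \<mu> (T \<inter> cball \<rho> r) + emeasure \<mu> ?W"
    using B over_sphere_in_sets[OF r] by (rule emeasure_subadditive)
  also have "\<dots> < \<infinity>" using finite_on_balls[of r] finite_over_spheres[OF r] by simp
  finally obtain m where m: "0 \<le> m" "emeasure \<mu> ?V = ennreal m"
    by (cases "emeasure \<mu> ?V") auto
  have RT: "R \<subseteq> T" using subtreeD(2)[OF subtree_mass_erased] .
  have sub: "fringe T \<rho> x \<subseteq> ?V" if x: "x \<in> (R - S) \<inter> cball \<rho> r" for x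
  proof
    have xT: "x \<in> T" using x RT by blast
    fix z assume "z \<in> fringe T \<rho> x"
    then have z: "z \<in> T" "x \<preceq> z" by (simp_all add: fringe_eq[OF xT])
    show "z \<in> ?V"
    proof (cases "dist \<rho> z \<le> r")
      case True
      then show ?thesis using z by simp
    next
      case False
      then obtain p where p: "p \<in> T" "p \<preceq> z" "dist \<rho> p = r"
        using ancestor_at_height[OF z(1), of r] r by auto
      \<comment> \<open>Both are ancestors of \<open>z\<close>, and \<open>x\<close> is the lower
        one. Since \<open>x\<close> is outside \<open>S\<close>, so is \<open>p\<close>, and the
        fringe of \<open>p\<close> is part of \<open>?W\<close>.\<close>
      have "x \<preceq> p" using btw_linear[OF root_in z(1) xT p(1) z(2) p(2)] p(3) x by simp
      then have "p \<notin> S" using subtreeD(3)[OF subtree_Skel _ xT] x by blast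
      then have "p \<in> sphere \<rho> r \<inter> finite_part T \<rho> \<mu>" "z \<in> fringe T \<rho> p"
        using p z unfolding finite_part_def by (auto simp: fringe_eq)
      then show ?thesis by blast
    qed
  qed
  have "card A \<le> nat \<lceil>m / h\<rceil>" if A: "A \<subseteq> (R - S) \<inter> cball \<rho> r" "finite A" "antichain A" for A
  proof -
    have AT: "A \<subseteq> T" using A(1) RT by blast
    have "disjoint_family_on (fringe T \<rho>) A"
      unfolding disjoint_family_on_def
    proof (intro ballI impI)
      fix x y assume xy: "x \<in> A" "y \<in> A" "x \<noteq> y"
      then have T: "x \<in> T" "y \<in> T" using AT by auto
      have "\<not> x \<preceq> y" "\<not> y \<preceq> x" using xy A(3) unfolding antichain_def by auto
      then show "fringe T \<rho> x \<inter> fringe T \<rho> y = {}"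
        using below_linear[OF T] by (auto simp: fringe_eq T)
    qed
    moreover have "fringe T \<rho> ` A \<subseteq> sets \<mu>" using fringe_in_sets AT by blast
    ultimately have "(\<Sum>x\<in>A. emeasure \<mu> (fringe T \<rho> x)) = emeasure \<mu> (\<Union>x\<in>A. fringe T \<rho> x)"
      using A(2) by (intro sum_emeasure)
    also have "\<dots> \<le> emeasure \<mu> ?V" using sub A(1) by (intro emeasure_mono[OF _ V] UN_least) blast
    finally have "(\<Sum>x\<in>A. emeasure \<mu> (fringe T \<rho> x)) \<le> ennreal m" using m(2) by simp
    \<comment> \<open>The root is in \<open>S\<close>, so the points of \<open>A\<close> belong to
      \<open>R\<close> through the mass condition.\<close>
    moreover have "of_nat (card A) * ennreal h \<le> (\<Sum>x\<in>A. emeasure \<mu> (fringe T \<rho> x))"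
      using A(1) unfolding mass_erased_def Skel_def by (intro sum_bounded_below) auto
    ultimately have "of_nat (card A) * ennreal h \<le> ennreal m" by order
    then have "ennreal (real (card A) * h) \<le> ennreal m"
      using h_pos by (simp add: ennreal_of_nat_eq_real_of_nat ennreal_mult)
    then have "real (card A) \<le> m / h"
      using m(1) h_pos by (simp add: field_simps)
    then show ?thesis by linarith
  qed
  then show ?thesis unfolding finite_width_def by blast
qed

section \<open>Completeness of the mass-erased subtree\<close>

lemma complete_mass_erased: "complete R"
proof -
  have RT: "R \<subseteq> T" using subtreeD(2)[OF subtree_mass_erased] .
  have "closed R"
    unfolding closed_sequential_limits
  proof (intro allI impI, elim conjE, rule ccontr)
    fix s \<sigma> assume s: "\<forall>n. s n \<in> R" and lim: "s \<longlonglongrightarrow> \<sigma>" and \<sigma>R: "\<sigma> \<notin> R"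
    have \<sigma>T: "\<sigma> \<in> T" using closed_sequentially[OF closed_T _ lim] s RT by blast
    have "\<sigma> \<in> - S" using \<sigma>R Skel_subset_mass_erased by blast
    then obtain e where e: "e > 0" "ball \<sigma> e \<subseteq> - S"
      using complete_imp_closed[OF complete_Skel] openE open_Compl by metis
    then have e\<rho>: "e \<le> dist \<sigma> \<rho>"
      using subtreeD(1)[OF subtree_Skel] by (meson ComplD linorder_not_le mem_ball subsetD)
    \<comment> \<open>The factor is at most 1/2, so the points at distance \<open>\<delta> n\<close>
      from \<open>\<sigma>\<close> on the way to the root exist and lie in the ball that misses
      \<open>S\<close>.\<close>
    define \<delta> where "\<delta> n = e * inverse (real (Suc (Suc n)))" for n
    have \<delta>: "0 < \<delta> n" "\<delta> n < e" for n
      using e(1) unfolding \<delta>_def by (auto simp: field_simps intro: add_pos_nonneg)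
    have \<delta>_mono: "\<delta> k \<le> \<delta> n" if "n \<le> k" for n k
      using e(1) that unfolding \<delta>_def by (intro mult_left_mono le_imp_inverse_le) auto
    have \<delta>_lim: "\<delta> \<longlonglongrightarrow> 0" unfolding \<delta>_def
      by (intro tendsto_mult_right_zero LIMSEQ_Suc[OF LIMSEQ_inverse_real_of_nat])
    have "\<forall>n. \<exists>p. p \<in> T \<and> dist \<sigma> p = \<delta> n \<and> btw \<sigma> p \<rho>"
    proof
      fix n
      have "0 \<le> \<delta> n" "\<delta> n \<le> dist \<sigma> \<rho>" using \<delta>[of n] e\<rho> by linarith+
      then show "\<exists>p. p \<in> T \<and> dist \<sigma> p = \<delta> n \<and> btw \<sigma> p \<rho>"
        using ex_point[OF \<sigma>T root_in] by blast
    qed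
    then obtain p where "\<And>n. p n \<in> T \<and> dist \<sigma> (p n) = \<delta> n \<and> btw \<sigma> (p n) \<rho>"
      by (elim choice[THEN exE]) blast
    then have p: "p n \<in> T" "dist (p n) \<sigma> = \<delta> n" "p n \<preceq> \<sigma>" for n
      using btw_commute[of \<sigma> "p n" \<rho>] dist_commute[of \<sigma> "p n"] by simp_all
    have p\<rho>: "dist \<rho> (p n) = dist \<rho> \<sigma> - \<delta> n" for n
      using p(2,3)[of n] unfolding btw_def by linarith
    have pS: "p n \<notin> S" for n
      using p(2)[of n] \<delta>(2)[of n] e(2) dist_commute[of \<sigma> "p n"] by (auto simp: subset_iff)
    \<comment> \<open>A term \<open>s k\<close> closer to \<open>\<sigma>\<close> than
      \<open>\<delta> n\<close> leaves the path from the root to \<open>\<sigma>\<close> above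
      \<open>p n\<close>, so \<open>p n\<close> is below \<open>s k\<close>.\<close>
    have pR: "p n \<in> R" for n
    proof -
      obtain k where k: "dist (s k) \<sigma> < \<delta> n"
        using lim \<delta>(1)[of n] unfolding lim_sequentially by blast
      have sT: "s k \<in> T" using s RT by blast
      obtain m where m: "m \<in> T" "m \<preceq> s k" "m \<preceq> \<sigma>" "btw (s k) m \<sigma>"
        using median[OF root_in sT \<sigma>T] by blast
      have "dist m \<sigma> \<le> dist (s k) \<sigma>"
        using m(4) zero_le_dist[of "s k" m] unfolding btw_def by linarith
      then have "dist \<rho> (p n) \<le> dist \<rho> m" using m(3) k p\<rho>[of n] unfolding btw_def by linarith
      then have "p n \<preceq> m" using btw_linear[OF root_in \<sigma>T p(1) m(1) p(3) m(3)] by blast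
      then show ?thesis
        using subtreeD(3)[OF subtree_mass_erased s[rule_format] p(1)] below_trans[OF _ m(2)] by blast
    qed
    have "fringe T \<rho> (p k) \<subseteq> fringe T \<rho> (p n)" if "n \<le> k" for n k
      using btw_linear[OF root_in \<sigma>T p(1) p(1) p(3) p(3), of n k] \<delta>_mono[OF that] p\<rho>
      by (intro fringe_mono p(1)) simp
    then have dec: "decseq (\<lambda>n. fringe T \<rho> (p n))" unfolding decseq_def by blast
    have p_lim: "p \<longlonglongrightarrow> \<sigma>" using \<delta>_lim p(2) tendsto_dist_iff[of p \<sigma> sequentially] by simp
    have "(\<Inter>n. fringe T \<rho> (p n)) = fringe T \<rho> \<sigma>"
    proof (intro equalityI subsetI)
      fix z assume "z \<in> (\<Inter>n. fringe T \<rho> (p n))"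
      then have z: "z \<in> T" "\<And>n. p n \<preceq> z" using fringe_eq[OF p(1)] by auto
      have "(\<lambda>n. dist \<rho> (p n) + dist (p n) z) \<longlonglongrightarrow> dist \<rho> \<sigma> + dist \<sigma> z"
        by (intro tendsto_intros p_lim)
      then have "(\<lambda>n. dist \<rho> z) \<longlonglongrightarrow> dist \<rho> \<sigma> + dist \<sigma> z" using z(2) unfolding btw_def by simp
      then have "\<sigma> \<preceq> z" unfolding LIMSEQ_const_iff btw_def by simp
      then show "z \<in> fringe T \<rho> \<sigma>" using z(1) fringe_eq[OF \<sigma>T] by simp
    next
      fix z assume "z \<in> fringe T \<rho> \<sigma>"
      then show "z \<in> (\<Inter>n. fringe T \<rho> (p n))" using fringe_mono[OF p(1) \<sigma>T p(3)] by blast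
    qed
    \<comment> \<open>Finite mass, which holds outside \<open>S\<close>, is what continuity from
      above requires.\<close>
    moreover have "emeasure \<mu> (fringe T \<rho> (p n)) \<noteq> \<infinity>" "ennreal h \<le> emeasure \<mu> (fringe T \<rho> (p n))" for n
      using pR[of n] pS[of n] p(1)[of n] unfolding Skel_def mass_erased_def by auto
    ultimately have "ennreal h \<le> emeasure \<mu> (fringe T \<rho> \<sigma>)"
      using Lim_emeasure_decseq[OF _ dec, of \<mu>] fringe_in_sets p(1)
      by (intro LIMSEQ_le_const[of "\<lambda>n. emeasure \<mu> (fringe T \<rho> (p n))"]) (auto simp: image_subset_iff)
    then show False using \<sigma>R \<sigma>T unfolding mass_erased_def by simp
  qed
  then have "complete (T \<inter> R)" using complete_T by (intro complete_Int_closed)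
  then show ?thesis using RT by (simp add: Int_absorb1)
qed

end

section \<open>Finite and discretely infinite measures together\<close>

theorem lemma2p7:
  fixes T :: "'a::metric_space set" and \<rho> :: 'a and \<mu> :: "'a measure"
  assumes "polish_R_tree T \<rho>"
    and "\<mu> \<in> di_measures T \<rho>"
  shows "\<forall>h>0. discrete_R_tree (mass_erased T \<rho> \<mu> h) \<rho>"
proof (intro allI impI)
  fix h :: real assume h: "h > 0"
  interpret rooted_R_tree T \<rho>
    using assms(1) unfolding polish_R_tree_def by unfold_locales blast
  have T: "complete T" using assms(1) unfolding polish_R_tree_def by blast
  have hyps: "sets \<mu> = sets (restrict_space borel T) \<and> discrete_R_tree (Skel T \<rho> \<mu>) \<rho> \<and>
    (\<forall>r. emeasure \<mu> (T \<inter> cball \<rho> r) < \<infinity>) \<and>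
    (\<forall>r>0. emeasure \<mu> (\<Union>\<sigma>\<in>sphere \<rho> r \<inter> finite_part T \<rho> \<mu>. fringe T \<rho> \<sigma>) < \<infinity>)"
    using assms(2) unfolding di_measures_def
  proof
    assume "\<mu> \<in> finite_measures T"
    then have sets: "sets \<mu> = sets (restrict_space borel T)" and "finite_measure \<mu>"
      unfolding finite_measures_def borel_measures_on_def by auto
    then have fin: "emeasure \<mu> A < \<infinity>" for A
      using finite_measure.emeasure_finite[of \<mu> A] by (simp add: top.not_eq_extremum)
    \<comment> \<open>No fringe has infinite mass, so the skeleton reduces to the root, which it
      contains by definition.\<close>
    then have "Skel T \<rho> \<mu> = {\<rho>}"
      using less_imp_neq[OF fin] unfolding Skel_def by blast
    then show ?thesis using sets fin discrete_R_tree_singleton by simp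
  next
    assume "\<mu> \<in> {\<mu>. discretely_infinite T \<rho> \<mu>}"
    then have bf: "\<mu> \<in> boundedly_finite_measures T" and rest: "discrete_R_tree (Skel T \<rho> \<mu>) \<rho>"
      "\<forall>r>0. emeasure \<mu> (\<Union>\<sigma>\<in>sphere \<rho> r \<inter> finite_part T \<rho> \<mu>. fringe T \<rho> \<sigma>) < \<infinity>"
      unfolding discretely_infinite_def by auto
    then have sets: "sets \<mu> = sets (restrict_space borel T)"
      unfolding boundedly_finite_measures_def borel_measures_on_def by auto
    have "emeasure \<mu> (T \<inter> cball \<rho> r) < \<infinity>" for r
    proof -
      have "T \<inter> cball \<rho> r \<in> sets \<mu>" unfolding sets sets_restrict_space by simp
      moreover have "bounded (T \<inter> cball \<rho> r)" by (simp add: bounded_Int)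
      ultimately show ?thesis using bf unfolding boundedly_finite_measures_def by blast
    qed
    then show ?thesis using sets rest by blast
  qed
  have "complete (Skel T \<rho> \<mu>)" using hyps unfolding discrete_R_tree_def by blast
  then interpret measured_R_tree T \<rho> \<mu> h
    using T hyps h by unfold_locales blast+
  show "discrete_R_tree (mass_erased T \<rho> \<mu> h) \<rho>"
    by (rule discrete_R_tree_extend[OF subtree_mass_erased subtree_Skel complete_mass_erased])
      (use hyps finite_width_outside_Skel in blast)+
qed

end
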